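(* There exist constants $\varepsilon>0$ and $c'>0$ such that for all sufficiently large $n$, any algorithm which, given sample access to two distributions $p,q$ over $[n]$, distinguishes with probability at least $2/3$ between the cases $d_{\chi^2}(p,q)\le\varepsilon^2/4$ and $d_{\mathrm{TV}}(p,q)\ge\varepsilon$, must use at least $c'\,n/\log n$ samples.
   Context: $d_{\chi^2}(p,q)=\sum_i(p_i-q_i)^2/q_i$; $d_{\mathrm{TV}}(p,q)=\frac12\sum_i|p_i-q_i|$. Equivalence testing: both distributions are accessed only through samples. *)

theory Defs
  imports "HOL-Probability.Probability" "HOL-Library.Extended_Nat"
begin

text \<open>
  A distribution over \<open>[n]\<close> is a \<open>nat pmf\<close> supported in \<open>{1..n}\<close>.
\<close>

definition dists :: "nat \<Rightarrow> nat pmf set" where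
  "dists n = {p. set_pmf p \<subseteq> {1..n}}"

text \<open>
  Division in \<^typ>\<open>ennreal\<close> gives the usual conventions for vanishing denominators:
  a summand with \<open>q\<^sub>i = 0\<close> is \<open>\<infinity>\<close> if \<open>p\<^sub>i > 0\<close>, and \<open>0\<close> if also \<open>p\<^sub>i = 0\<close>.
\<close>

definition chi2_dist :: "nat \<Rightarrow> nat pmf \<Rightarrow> nat pmf \<Rightarrow> ennreal" where
  "chi2_dist n p q = (\<Sum>i=1..n. ennreal ((pmf p i - pmf q i)\<^sup>2) / ennreal (pmf q i))"

definition tv_dist :: "nat \<Rightarrow> nat pmf \<Rightarrow> nat pmf \<Rightarrow> real" where
  "tv_dist n p q = 1 / 2 * (\<Sum>i=1..n. \<bar>pmf p i - pmf q i\<bar>)"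

text \<open>
  A randomized, fully adaptive algorithm whose only access to \<open>p\<close> and \<open>q\<close> is by drawing
  samples: it answers, or uses internal randomness, or draws a fresh independent sample from
  \<open>p\<close> or from \<open>q\<close> and continues depending on the value observed. The step taken may depend
  on everything seen so far. Computational cost is not restricted.
\<close>

datatype tester =
    Answer bool
  | Randomize "tester pmf"
  | Sample_p "nat \<Rightarrow> tester"
  | Sample_q "nat \<Rightarrow> tester"

primrec run :: "nat pmf \<Rightarrow> nat pmf \<Rightarrow> tester \<Rightarrow> bool pmf" where
  "run p q (Answer b) = return_pmf b"
| "run p q (Randomize R) = join_pmf (map_pmf (run p q) R)"
| "run p q (Sample_p f) = bind_pmf p (\<lambda>i. run p q (f i))"
| "run p q (Sample_q f) = bind_pmf q (\<lambda>i. run p q (f i))"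

text \<open>
  Worst-case total number of samples (from \<open>p\<close> and \<open>q\<close> together), over all sample values in
  \<open>[n]\<close> and all outcomes of the internal randomness; \<open>\<infinity>\<close> if it is unbounded.
\<close>

primrec sample_complexity :: "nat \<Rightarrow> tester \<Rightarrow> enat" where
  "sample_complexity n (Answer b) = 0"
| "sample_complexity n (Randomize R) = Sup (set_pmf (map_pmf (sample_complexity n) R))"
| "sample_complexity n (Sample_p f) = eSuc (SUP i\<in>{1..n}. sample_complexity n (f i))"
| "sample_complexity n (Sample_q f) = eSuc (SUP i\<in>{1..n}. sample_complexity n (f i))"

text \<open>The answer \<open>True\<close> stands for ``close in \<open>\<chi>\<^sup>2\<close>'', \<open>False\<close> for ``far in total variation''.\<close>

definition distinguishes :: "nat \<Rightarrow> real \<Rightarrow> tester \<Rightarrow> bool" where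
  "distinguishes n \<epsilon> A \<longleftrightarrow>
     (\<forall>p\<in>dists n. \<forall>q\<in>dists n.
        (chi2_dist n p q \<le> ennreal (\<epsilon>\<^sup>2 / 4) \<longrightarrow> pmf (run p q A) True \<ge> 2 / 3) \<and>
        (tv_dist n p q \<ge> \<epsilon> \<longrightarrow> pmf (run p q A) False \<ge> 2 / 3))"

end

theory Submission imports Defs "HOL-Real_Asymp.Real_Asymp" begin

text \<open>
  Pair up the elements of \<open>[n]\<close> into sites. A site with parameters \<open>(x, w)\<close> carries the masses
  \<open>x + w\<close>, \<open>x - w\<close> under \<open>p\<close> and \<open>x - w\<close>, \<open>x + w\<close> under \<open>q\<close>, where \<open>w\<close> is either \<open>0\<close> or
  \<open>sqrt (t x)\<close> with a random sign. A site with \<open>w \<noteq> 0\<close> adds about \<open>8 t\<close> to the \<open>\<chi>\<^sup>2\<close> distance,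
  whatever \<open>x\<close> is, and \<open>2 sqrt (t x)\<close> to the total variation distance. The parameters of the
  sites are independent; \<open>x\<close> has the same law in the close and in the far case, and the two
  cases differ only in which values of \<open>x\<close> come with \<open>w \<noteq> 0\<close>: a few heavy ones in the close
  case, many light ones in the far case.

  If the measures of the two kinds of values have equal moments of orders \<open>1, \<dots>, K + 1\<close>, then
  the laws of \<open>(x, w)\<close> agree on all polynomials of degree at most \<open>K + 1\<close>. The acceptance
  probability of a tester with \<open>k\<close> samples is a polynomial in the parameters of one site whose
  coefficients are dominated by those of \<open>(1 + 6 X)\<^sup>k\<close>, so replacing the law of one site changes
  it by an amount exponentially small in \<open>K\<close> as long as \<open>k\<close> times the largest value of \<open>x\<close> is a
  small multiple of \<open>K\<close>. With \<open>K\<close> of order \<open>ln n\<close> the sites can be replaced one by one.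

  Measures with matching moments supported on an interval \<open>[a, C K\<^sup>2 a]\<close> come from the alternating
  sum over Chebyshev nodes, which annihilates polynomials of low degree; weighting it by a Fejer kernel puts a constant fraction of its mass on the node \<open>0\<close>,
  and the node \<open>0\<close> is then moved to a point \<open>a\<close> much smaller than the other nodes.
\<close>

section \<open>Alternating sums over Chebyshev nodes\<close>

text \<open>The summands are the real parts of the powers of an \<open>M\<close>-th root of unity
  other than 1, and the geometric sum of these powers vanishes.\<close>

lemma sum_cos_roots_of_unity:
  fixes M :: nat and e :: int
  assumes "M > 0" "\<not> int M dvd e"
  shows "(\<Sum>j<M. cos (2 * pi * e * real j / M)) = 0"
proof -
  define z where "z = cis (2 * pi * e / M)"
  have "z \<noteq> 1"
  proof
    assume "z = 1"
    hence "cos (2 * pi * e / M) = 1"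
      by (metis z_def cis.sel(1) one_complex.sel(1))
    then obtain x :: int where "2 * pi * e / M = x * 2 * pi"
      by (auto simp: cos_one_2pi_int)
    hence "real_of_int e = x * M"
      using assms(1) by (simp add: field_simps)
    hence "e = x * int M"
      by (metis of_int_eq_iff of_int_mult of_int_of_nat_eq)
    thus False using assms(2) by simp
  qed
  moreover have "z ^ M = 1"
  proof -
    have "z ^ M = cis (real M * (2 * pi * e / M))"
      unfolding z_def by (rule Complex.DeMoivre)
    also have "real M * (2 * pi * e / M) = 2 * pi * e"
      using assms(1) by simp
    finally show ?thesis by (simp add: cis_multiple_2pi)
  qed
  ultimately have "(\<Sum>j<M. z ^ j) = 0"
    by (simp add: geometric_sum)
  hence "Re (\<Sum>j<M. z ^ j) = 0" by simp
  thus ?thesis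
    by (simp add: z_def Complex.DeMoivre mult_ac)
qed

text \<open>The sign \<open>(-1) ^ j\<close> equals cos (\<pi> j) and shifts the frequency from
  \<open>d\<close> to \<open>d + m\<close>, which lies strictly between 0 and
  \<open>2 * m\<close>.\<close>

lemma alternating_sum_cos:
  fixes m :: nat and d :: int
  assumes "\<bar>d\<bar> < int m"
  shows "(\<Sum>j<2*m. (-1) ^ j * cos (pi * d * j / m)) = 0"
proof -
  have m: "m > 0" using assms by linarith
  have "(-1) ^ j * cos (pi * d * j / m) = cos (2 * pi * (d + int m) * real j / real (2 * m))" for j
  proof -
    have "2 * pi * (d + int m) * real j / real (2 * m) = pi * d * j / m + pi * j"
      using m by (simp add: field_simps)
    thus ?thesis by (simp add: cos_add mult.commute)
  qed
  hence "(\<Sum>j<2*m. (-1) ^ j * cos (pi * d * j / m))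
      = (\<Sum>j<2*m. cos (2 * pi * (d + int m) * real j / real (2 * m)))"
    by simp
  also have "\<dots> = 0"
  proof (rule sum_cos_roots_of_unity)
    have "0 < d + int m" "d + int m < int (2 * m)" using assms by auto
    thus "\<not> int (2 * m) dvd d + int m" using zdvd_not_zless by blast
  qed (use m in simp)
  finally show ?thesis .
qed

text \<open>One factor 1 - cos spreads the frequency \<open>d\<close> over \<open>d - 1\<close>,
  \<open>d\<close> and \<open>d + 1\<close>, so each factor costs one unit of the gap between the
  absolute value of \<open>d\<close> and \<open>m\<close>.\<close>

lemma alternating_sum_cos_mult_power:
  fixes m i :: nat and d :: int
  assumes "\<bar>d\<bar> + int i < int m"
  shows "(\<Sum>j<2*m. (-1) ^ j * cos (pi * d * j / m) * (1 - cos (pi * j / m)) ^ i) = 0"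
  using assms
proof (induction i arbitrary: d)
  case 0
  thus ?case using alternating_sum_cos by simp
next
  case (Suc i)
  let ?S = "\<lambda>d::int. (\<Sum>j<2*m. (-1) ^ j * cos (pi * d * j / m) * (1 - cos (pi * j / m)) ^ i)"
  have m: "real m > 0" using Suc.prems by linarith
  have "cos (pi * d * j / m) * (1 - cos (pi * j / m))
      = cos (pi * d * j / m) - cos (pi * (d + 1) * j / m) / 2 - cos (pi * (d - 1) * j / m) / 2" for j :: nat
  proof -
    have "pi * (d + 1) * j / m = pi * d * j / m + pi * j / m"
         "pi * (d - 1) * j / m = pi * d * j / m - pi * j / m"
      using m by (simp_all add: field_simps)
    thus ?thesis by (simp only: cos_add cos_diff) (simp add: field_simps)
  qed
  moreover have "s * a * (1 - q) ^ Suc i = s * A * (1 - q) ^ i - s * B * (1 - q) ^ i / 2 - s * C * (1 - q) ^ i / 2"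
    if "a * (1 - q) = A - B / 2 - C / 2" for s a q A B C :: real
  proof -
    have "s * a * (1 - q) ^ Suc i = s * (a * (1 - q)) * (1 - q) ^ i" by simp
    thus ?thesis unfolding that by (simp add: field_simps)
  qed
  ultimately have "(\<Sum>j<2*m. (-1) ^ j * cos (pi * d * j / m) * (1 - cos (pi * j / m)) ^ Suc i)
      = ?S d - ?S (d + 1) / 2 - ?S (d - 1) / 2"
    by (simp only: sum_subtractf sum_divide_distrib)
  moreover have "?S d = 0" "?S (d + 1) = 0" "?S (d - 1) = 0"
    by (rule Suc.IH; use Suc.prems in linarith)+
  ultimately show ?case by simp
qed

text \<open>The squared modulus of the sum of exp (i l \<theta>) over \<open>l < K\<close>, that is,
  the Fejer kernel without its normalizing factor. It is nonnegative and has frequencies below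
  \<open>K\<close> only.\<close>

definition fejer :: "nat \<Rightarrow> real \<Rightarrow> real" where
  "fejer K \<theta> = (\<Sum>l<K. cos (real l * \<theta>))\<^sup>2 + (\<Sum>l<K. sin (real l * \<theta>))\<^sup>2"

lemma fejer_nonneg: "fejer K \<theta> \<ge> 0"
  by (simp add: fejer_def)

lemma fejer_0: "fejer K 0 = (real K)\<^sup>2"
  by (simp add: fejer_def)

lemma fejer_eq_sum_cos: "fejer K \<theta> = (\<Sum>l<K. \<Sum>l'<K. cos (real_of_int (int l - int l') * \<theta>))"
  by (simp add: fejer_def power2_eq_square sum_product left_diff_distrib cos_diff sum.distrib)

text \<open>Frequency differences are smaller than \<open>4 * K\<close> in absolute value, so only
  the \<open>K\<close> diagonal terms survive. Compared with \<open>fejer_0\<close>, the node 0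
  carries a quarter of the total weight.\<close>

lemma sum_fejer:
  assumes "K \<ge> 1"
  shows "(\<Sum>j<2*(2*K). fejer K (pi * real j / real (2*K))) = 4 * (real K)\<^sup>2"
proof -
  have "(\<Sum>j<2*(2*K). cos (real_of_int (int l - int l') * (pi * real j / real (2*K)))) = (if l = l' then 4 * real K else 0)"
    if "l < K" "l' < K" for l l'
  proof (cases "l = l'")
    case False
    have *: "2 * pi * real_of_int (int l - int l') * real j / real (2*(2*K))
        = real_of_int (int l - int l') * (pi * real j / real (2*K))" for j :: nat
      using assms by (simp add: field_simps)
    have "\<not> int (2*(2*K)) dvd int l - int l'"
    proof
      assume "int (2*(2*K)) dvd int l - int l'"
      moreover have "int l - int l' \<noteq> 0" using False by simp
      ultimately have "\<bar>int (2*(2*K))\<bar> \<le> \<bar>int l - int l'\<bar>" by (rule dvd_imp_le_int[rotated])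
      thus False using that by linarith
    qed
    from sum_cos_roots_of_unity[OF _ this] show ?thesis
      using False assms unfolding * by simp
  qed simp
  hence "(\<Sum>l<K. \<Sum>l'<K. \<Sum>j<2*(2*K). cos (real_of_int (int l - int l') * (pi * real j / real (2*K))))
     = (\<Sum>l<K. \<Sum>l'<K. if l = l' then 4 * real K else 0)"
    by (intro sum.cong refl) auto
  also have "\<dots> = 4 * (real K)\<^sup>2"
    by (simp add: power2_eq_square)
  finally show ?thesis
    unfolding fejer_eq_sum_cos
    by (subst sum.swap, subst sum.swap[of _ "{..<K}" "{..<2*(2*K)}"])
qed

text \<open>The kernel has frequencies up to \<open>K - 1\<close> and the power adds at most
  \<open>K\<close>; the total stays below the half period \<open>2 * K\<close>.\<close>

lemma alternating_sum_fejer_mult_power: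
  assumes "i \<le> K" "K \<ge> 1"
  shows "(\<Sum>j<2*(2*K). (-1) ^ j * fejer K (pi * real j / real (2*K)) * (1 - cos (pi * real j / real (2*K))) ^ i) = 0"
proof -
  let ?t = "\<lambda>l l' (j::nat). (-1) ^ j * cos (pi * real_of_int (int l - int l') * real j / real (2*K))
       * (1 - cos (pi * real j / real (2*K))) ^ i"
  have "(\<Sum>j<2*(2*K). (-1) ^ j * fejer K (pi * real j / real (2*K)) * (1 - cos (pi * real j / real (2*K))) ^ i)
     = (\<Sum>j<2*(2*K). \<Sum>l<K. \<Sum>l'<K. ?t l l' j)"
    unfolding fejer_eq_sum_cos
    by (simp add: sum_distrib_left sum_distrib_right mult_ac)
  also have "\<dots> = (\<Sum>l<K. \<Sum>l'<K. \<Sum>j<2*(2*K). ?t l l' j)"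
    by (subst sum.swap) (intro sum.cong refl sum.swap)
  also have "\<dots> = 0"
    by (intro sum.neutral ballI alternating_sum_cos_mult_power) (use assms in auto)
  finally show ?thesis .
qed

section \<open>Distance of the remaining nodes from the node 0\<close>

lemma sin_ge_half:
  fixes x :: real
  assumes "0 \<le> x" "x \<le> 1"
  shows "sin x \<ge> x / 2"
proof (cases "x = 0")
  case False
  then obtain z where z: "0 < z" "z < x" "sin x - sin 0 = (x - 0) * cos z"
    using MVT2[of 0 x sin cos] assms by (auto intro: DERIV_sin)
  have "cos z \<ge> cos (pi / 3)"
    using z assms pi_gt3 by (intro cos_monotone_0_pi_le) auto
  hence "cos z \<ge> 1 / 2" by (simp add: cos_60)
  thus ?thesis using z assms mult_left_mono[of "1/2" "cos z" x] by simp
qed simp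

text \<open>On [0, \<pi>] the cosine decreases; a node \<open>j\<close> beyond \<open>2 * K\<close>
  has the same cosine as its mirror image \<open>4 * K - j\<close>.\<close>

lemma one_minus_cos_nodes:
  fixes K j :: nat
  assumes "K \<ge> 1" "1 \<le> j" "j < 2*(2*K)"
  shows "1 - cos (pi * real j / real (2*K)) \<ge> 1 - cos (pi / real (2*K))"
proof -
  have le: "cos (pi * real j / real (2*K)) \<le> cos (pi / real (2*K))" if "1 \<le> j" "j \<le> 2*K" for j :: nat
    using that assms by (intro cos_monotone_0_pi_le) (auto simp: field_simps)
  show ?thesis
  proof (cases "j \<le> 2*K")
    case False
    have "pi * real j / real (2*K) = 2 * pi - pi * real (2*(2*K) - j) / real (2*K)"
      using assms by (simp add: of_nat_diff field_simps)
    hence "cos (pi * real j / real (2*K)) = cos (pi * real (2*(2*K) - j) / real (2*K))"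
      by (simp add: cos_diff)
    thus ?thesis using le[of "2*(2*K) - j"] False assms by auto
  qed (use le assms in auto)
qed

lemma one_minus_cos_first_node:
  assumes "K \<ge> 1"
  shows "1 - cos (pi / real (2*K)) \<ge> 1 / (8 * (real K)\<^sup>2)"
proof -
  define x where "x = pi / real (4*K)"
  have x: "0 \<le> x" "x \<le> 1" "x \<ge> 1 / (2 * K)"
    using assms pi_less_4 pi_gt3 by (auto simp: x_def field_simps)
  have "sin x \<ge> x / 2" by (rule sin_ge_half) (use x in auto)
  hence "sin x \<ge> 1 / (4 * K)" using x by simp
  hence "(sin x)\<^sup>2 \<ge> (1 / (4 * K))\<^sup>2" by (intro power_mono) auto
  moreover have "1 - cos (2 * x) = 2 * (sin x)\<^sup>2"
    by (simp add: cos_double_sin)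
  moreover have "2 * x = pi / real (2*K)" by (simp add: x_def)
  ultimately have "1 - cos (pi / real (2*K)) \<ge> 2 * (1 / (4 * K))\<^sup>2" by simp
  thus ?thesis by (simp add: power2_eq_square)
qed

text \<open>Dividing the weights of the alternating Fejer sum by \<open>Y j - a\<close> and moving
  the node 0 to \<open>a\<close> yields measures on even and odd nodes with equal moments of orders
  1 to \<open>K + 1\<close>. The moments of order 0 differ: almost all mass sits on the even node
  0.\<close>

lemma ex_alternating_moment_pmf:
  assumes K: "K \<ge> 1"
  obtains \<pi> :: "nat pmf" and y :: "nat \<Rightarrow> real" and a :: real where
    "set_pmf \<pi> \<subseteq> {..<4*K}" "a > 0" "1 / a \<le> 80000000 * (real K)\<^sup>2" "y 0 = a"
    "\<And>j. j \<in> {1..<4*K} \<Longrightarrow> 7 * a \<le> y j" "\<And>j. j < 4*K \<Longrightarrow> a \<le> y j" "\<And>j. j < 4*K \<Longrightarrow> y j \<le> 2"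
    "\<And>i. 1 \<le> i \<Longrightarrow> i \<le> Suc K \<Longrightarrow> (\<Sum>j<4*K. (-1) ^ j * pmf \<pi> j * y j ^ i) = 0"
    "pmf \<pi> 0 \<ge> 1 / 2" "(\<Sum>j\<in>{1..<4*K}. pmf \<pi> j) \<le> 7 / 10000000"
    "(\<Sum>j<4*K. pmf \<pi> j * y j) \<le> 10 * a"
proof -
  define h where "h = 1 - cos (pi / real (2*K))"
  have h: "h \<ge> 1 / (8 * (real K)\<^sup>2)"
    unfolding h_def by (rule one_minus_cos_first_node[OF K])
  have K2: "(real K)\<^sup>2 > 0" using K by simp
  have h0: "h > 0" using h K2 by (smt (verit) divide_pos_pos)
  \<comment> \<open>The factor makes the mass of all other nodes at most
    \<open>7 / 10000000\<close>, small enough for the close case. It also puts these nodes far above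
    \<open>7 * a\<close>.\<close>
  define a where "a = h / 10000000"
  have a0: "a > 0" using h0 by (simp add: a_def)
  have h_a: "h = 10000000 * a" by (simp add: a_def)
  define Y where "Y j = 1 - cos (pi * real j / real (2*K))" for j :: nat
  define F where "F j = fejer K (pi * real j / real (2*K))" for j :: nat
  define G where "G j = F j / (Y j - a)" for j
  define R where "R = {1..<4*K}"
  have ins: "{..<4*K} = insert 0 R" "0 \<notin> R" "finite R" using K by (auto simp: R_def)
  have R_iff: "j \<in> R \<longleftrightarrow> j \<noteq> 0 \<and> j < 4*K" for j by (auto simp: R_def)
  have Y: "h \<le> Y j" "Y j \<le> 2" "Y j - a > 0" "h / 2 \<le> Y j - a" "Y j \<le> 2 * (Y j - a)" if "j \<in> R" for j
  proof -
    show *: "h \<le> Y j" using one_minus_cos_nodes[OF K, of j] that by (simp add: h_def Y_def R_def)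
    show "Y j \<le> 2" using cos_ge_minus_one[of "pi * real j / real (2*K)"] unfolding Y_def by linarith
    show "Y j - a > 0" "h / 2 \<le> Y j - a" "Y j \<le> 2 * (Y j - a)" using * a0 by (auto simp: h_a)
  qed
  have Y0: "Y 0 = 0" and F0: "F 0 = (real K)\<^sup>2" by (simp_all add: Y_def F_def fejer_0)
  have F: "F j \<ge> 0" for j by (simp add: F_def fejer_nonneg)
  have sumF: "(\<Sum>j\<in>R. F j) = 3 * (real K)\<^sup>2"
  proof -
    have "(\<Sum>j<4*K. F j) = 4 * (real K)\<^sup>2" using sum_fejer[OF K] by (simp add: F_def)
    thus ?thesis unfolding ins using ins F0 by simp
  qed
  have G: "G j \<ge> 0" "G j \<le> 2 / h * F j" "G j * Y j \<le> 2 * F j" if "j \<in> R" for j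
  proof -
    show "G j \<ge> 0" using F[of j] Y(3)[OF that] by (simp add: G_def)
    have "F j / (Y j - a) \<le> F j / (h / 2)"
      using F[of j] Y[OF that] h0 by (intro divide_left_mono) auto
    thus "G j \<le> 2 / h * F j" by (simp add: G_def field_simps)
    have "F j * Y j \<le> F j * (2 * (Y j - a))"
      using F[of j] Y(5)[OF that] by (intro mult_left_mono)
    thus "G j * Y j \<le> 2 * F j" using Y(3)[OF that] by (simp add: G_def field_simps)
  qed
  \<comment> \<open>Up to sign, \<open>g\<close> is the value of \<open>F j / (Y j - a)\<close> at
    the node 0, where \<open>Y 0 = 0\<close>.\<close>
  define g where "g = (real K)\<^sup>2 / a"
  have g0: "g > 0" using K2 a0 by (simp add: g_def)
  have g_a: "(real K)\<^sup>2 = g * a" using a0 by (simp add: g_def)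
  have sumG: "(\<Sum>j\<in>R. G j) \<le> 6 / 10000000 * g"
  proof -
    have "(\<Sum>j\<in>R. G j) \<le> (\<Sum>j\<in>R. 2 / h * F j)" by (intro sum_mono G)
    also have "\<dots> = 2 / h * (3 * (real K)\<^sup>2)" by (simp only: sum_distrib_left[symmetric] sumF)
    also have "\<dots> = 6 / 10000000 * g" using a0 by (simp add: g_def h_a field_simps)
    finally show ?thesis .
  qed
  have sumGY: "(\<Sum>j\<in>R. G j * Y j) \<le> 6 * (g * a)"
  proof -
    have "(\<Sum>j\<in>R. G j * Y j) \<le> (\<Sum>j\<in>R. 2 * F j)" by (intro sum_mono G)
    thus ?thesis by (simp add: sum_distrib_left[symmetric] sumF g_a)
  qed
  have sumG0: "(\<Sum>j\<in>R. G j) \<ge> 0" by (intro sum_nonneg G)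
  \<comment> \<open>This collects the coefficients of \<open>a ^ i\<close> when the vanishing sum is
    applied to the divided difference of \<open>v ^ i\<close> at \<open>a\<close>; hence the same
    \<open>c0\<close> serves every order \<open>i\<close>.\<close>
  define c0 where "c0 = g - (\<Sum>j\<in>R. (-1) ^ j * G j)"
  have alt: "\<bar>\<Sum>j\<in>R. (-1) ^ j * G j\<bar> \<le> (\<Sum>j\<in>R. G j)"
    by (rule order_trans[OF sum_abs]) (intro sum_mono, simp add: abs_mult power_abs G)
  have c0: "c0 \<ge> g / 2" "c0 \<ge> 99 / 100 * g" "c0 \<le> 101 / 100 * g"
    using alt sumG g0 unfolding c0_def by (auto simp: abs_le_iff)
  define c where "c j = (if j = 0 then c0 else G j)" for j
  define Z where "Z = (\<Sum>j<4*K. c j)"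
  have csum: "(\<Sum>j\<in>R. c j * f j) = (\<Sum>j\<in>R. G j * f j)" for f :: "nat \<Rightarrow> real"
    by (intro sum.cong refl) (auto simp: c_def R_iff)
  have Zeq: "Z = c0 + (\<Sum>j\<in>R. G j)"
    using csum[of "\<lambda>_. 1"] unfolding Z_def ins using ins by (simp add: c_def)
  have Z: "Z \<ge> 99 / 100 * g" "Z \<le> 102 / 100 * g" "Z > 0"
    using c0 sumG sumG0 g0 unfolding Zeq by auto
  have cnn: "c j \<ge> 0" if "j < 4*K" for j
    using that G(1)[of j] c0(1) g0 by (auto simp: c_def R_iff)
  define w where "w j = (if j < 4*K then c j / Z else 0)" for j
  define \<pi> where "\<pi> = embed_pmf w"
  have wnn: "w j \<ge> 0" for j using cnn Z by (simp add: w_def)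
  have "(\<integral>\<^sup>+j. ennreal (w j) \<partial>count_space UNIV) = (\<Sum>j<4*K. ennreal (w j))"
    by (subst nn_integral_count_space'[of "{..<4*K}"]) (auto simp: w_def)
  also have "\<dots> = ennreal (\<Sum>j<4*K. w j)" using wnn by (simp add: sum_ennreal)
  also have "(\<Sum>j<4*K. w j) = 1"
    using Z by (simp add: w_def Z_def sum_divide_distrib[symmetric])
  finally have pmf: "pmf \<pi> j = w j" for j
    unfolding \<pi>_def using wnn by (subst pmf_embed_pmf) auto
  have pmf_R: "pmf \<pi> j = G j / Z" if "j \<in> R" for j
    using that by (auto simp: pmf w_def c_def R_def)
  have pmf_0: "pmf \<pi> 0 = c0 / Z" using K by (simp add: pmf w_def c_def)
  define y where "y j = (if j = 0 then a else Y j)" for j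
  have y_R: "y j = Y j" if "j \<in> R" for j using that by (auto simp: y_def R_iff)
  have y0: "y 0 = a" by (simp add: y_def)
  show ?thesis
  proof (rule that[of \<pi> a y])
    show "set_pmf \<pi> \<subseteq> {..<4*K}" by (auto simp: set_pmf_eq pmf w_def split: if_splits)
    show "a > 0" by fact
    show "1 / a \<le> 80000000 * (real K)\<^sup>2"
      using h h0 K2 by (simp add: a_def field_simps)
    show "y 0 = a" by fact
    show "7 * a \<le> y j" if "j \<in> {1..<4*K}" for j
      using Y(1)[of j] y_R[of j] that a0 by (auto simp: R_def h_a)
    show "a \<le> y j" if "j < 4*K" for j
      using Y(1)[of j] y_R[of j] that a0 y0 by (cases "j = 0") (auto simp: h_a R_iff)
    show "y j \<le> 2" if "j < 4*K" for j
    proof (cases "j = 0")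
      case True
      have "1 \<in> R" using K by (simp add: R_def)
      from Y(1)[OF this] Y(2)[OF this] show ?thesis using True a0 by (simp add: y0 h_a)
    next
      case False
      thus ?thesis using that Y(2)[of j] y_R[of j] by (auto simp: R_iff)
    qed
    show "pmf \<pi> 0 \<ge> 1 / 2" using c0 Z g0 by (simp add: pmf_0 field_simps)
    have "(\<Sum>j\<in>R. pmf \<pi> j) = (\<Sum>j\<in>R. G j) / Z"
      by (simp add: pmf_R sum_divide_distrib)
    also have "\<dots> \<le> 7 / 10000000" using sumG Z g0 by (simp add: field_simps)
    finally show "(\<Sum>j\<in>{1..<4*K}. pmf \<pi> j) \<le> 7 / 10000000" by (simp add: R_def)
    have "(\<Sum>j<4*K. pmf \<pi> j * y j) = (c0 * a + (\<Sum>j\<in>R. G j * Y j)) / Z"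
      unfolding ins using ins by (simp add: pmf_R pmf_0 y_R y0 sum_divide_distrib add_divide_distrib)
    also have "\<dots> \<le> (101 / 100 * g * a + 6 * (g * a)) / Z"
      using c0(3) sumGY a0 Z by (intro divide_right_mono add_mono mult_right_mono) auto
    also have "\<dots> \<le> 10 * a"
    proof -
      have "701 / 100 * (g * a) \<le> 10 * (99 / 100 * g) * a" using a0 g0 by simp
      also have "\<dots> \<le> 10 * Z * a" using Z(1) a0 by (intro mult_right_mono mult_left_mono) auto
      finally show ?thesis using Z(3) by (simp add: field_simps)
    qed
    finally show "(\<Sum>j<4*K. pmf \<pi> j * y j) \<le> 10 * a" .
    show "(\<Sum>j<4*K. (-1) ^ j * pmf \<pi> j * y j ^ i) = 0" if i: "1 \<le> i" "i \<le> Suc K" for i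
    proof -
      \<comment> \<open>\<open>Q v = (v ^ i - a ^ i) / (v - a)\<close> has degree at most \<open>K\<close>, so it integrates to zero
         against the Fejer weights; its value at the node \<open>0\<close> produces the mass at \<open>a\<close>.\<close>
      define Q where "Q v = (\<Sum>l<i. a ^ (i - Suc l) * v ^ l)" for v
      have Q: "v ^ i - a ^ i = (v - a) * Q v" for v
        unfolding Q_def by (rule power_diff_sumr2)
      have "(\<Sum>j<4*K. (-1) ^ j * F j * Q (Y j)) =
          (\<Sum>l<i. a ^ (i - Suc l) * (\<Sum>j<4*K. (-1) ^ j * F j * Y j ^ l))"
        unfolding Q_def sum_distrib_left by (subst sum.swap) (simp add: mult_ac)
      also have "\<dots> = 0"
      proof (intro sum.neutral ballI)
        fix l assume "l \<in> {..<i}"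
        hence "(\<Sum>j<4*K. (-1) ^ j * F j * Y j ^ l) = 0"
          using alternating_sum_fejer_mult_power[of l K] K i by (simp add: F_def Y_def)
        thus "a ^ (i - Suc l) * (\<Sum>j<4*K. (-1) ^ j * F j * Y j ^ l) = 0" by simp
      qed
      finally have "F 0 * Q 0 + (\<Sum>j\<in>R. (-1) ^ j * F j * Q (Y j)) = 0"
        unfolding ins using ins Y0 by simp
      moreover have "F 0 * Q 0 = g * a ^ i"
      proof -
        have "Q 0 * a = a ^ i" using Q[of 0] i by (simp add: zero_power mult.commute)
        thus ?thesis using a0 by (simp add: F0 g_a mult.commute)
      qed
      moreover have "(-1) ^ j * F j * Q (Y j) = (-1) ^ j * G j * Y j ^ i - (-1) ^ j * G j * a ^ i" if "j \<in> R" for j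
      proof -
        have "F j = G j * (Y j - a)" using Y(3)[OF that] by (simp add: G_def)
        hence "F j * Q (Y j) = G j * (Y j ^ i - a ^ i)" by (simp add: Q)
        thus ?thesis by (simp only: mult.assoc right_diff_distrib)
      qed
      ultimately have "g * a ^ i + ((\<Sum>j\<in>R. (-1) ^ j * G j * Y j ^ i) - (\<Sum>j\<in>R. (-1) ^ j * G j) * a ^ i) = 0"
        by (simp add: sum_subtractf sum_distrib_right)
      hence "c0 * a ^ i + (\<Sum>j\<in>R. (-1) ^ j * G j * Y j ^ i) = 0"
        by (simp add: c0_def algebra_simps)
      moreover have "(\<Sum>j<4*K. (-1) ^ j * pmf \<pi> j * y j ^ i)
           = (c0 * a ^ i + (\<Sum>j\<in>R. (-1) ^ j * G j * Y j ^ i)) / Z"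
        unfolding ins using ins
        by (simp add: pmf_R pmf_0 y_R y0 sum_divide_distrib add_divide_distrib)
      ultimately show ?thesis by simp
    qed
  qed
qed

section \<open>Acceptance probabilities under signed mixtures\<close>

lemma sample_complexity_RandomizeD:
  assumes "sample_complexity n (Randomize R) \<le> enat k" "A \<in> set_pmf R"
  shows "sample_complexity n A \<le> enat k"
proof -
  have "sample_complexity n A \<in> set_pmf (map_pmf (sample_complexity n) R)"
    using assms(2) by simp
  hence "sample_complexity n A \<le> sample_complexity n (Randomize R)"
    by (simp del: set_map_pmf add: Sup_upper)
  thus ?thesis using assms(1) by (rule order_trans)
qed

lemma eSuc_SUP_leE:
  fixes h :: "nat \<Rightarrow> enat"
  assumes "eSuc (SUP i\<in>I. h i) \<le> enat k"
  obtains k' where "k = Suc k'" "\<And>i. i \<in> I \<Longrightarrow> h i \<le> enat k'"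
proof (cases k)
  case 0
  thus ?thesis using assms by (simp add: enat_0)
next
  case (Suc k')
  hence "(SUP i\<in>I. h i) \<le> enat k'"
    using assms by (simp add: eSuc_enat[symmetric])
  hence "h i \<le> enat k'" if "i \<in> I" for i
    using that by (meson SUP_upper order_trans)
  thus ?thesis using that Suc by blast
qed

lemma pmf_bind_finite_support:
  assumes "set_pmf p \<subseteq> {1..n::nat}"
  shows "pmf (bind_pmf p f) b = (\<Sum>i=1..n. pmf p i * pmf (f i) b)"
  unfolding pmf_bind by (subst integral_measure_pmf[of "{1..n}"]) (use assms in auto)

text \<open>The law of a sample is affine in \<open>(X, W)\<close>, so averaging over the sample
  produces the old monomial prefactor and the two prefactors of degree one higher. The latter enter
  with total weights 4 and 2, which gives the factor \<open>1 + 6 * \<delta>\<close>.\<close>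

lemma perturbed_sample_step:
  fixes X W c :: "'z \<Rightarrow> real" and p :: "'z \<Rightarrow> nat pmf" and r :: "'z \<Rightarrow> nat \<Rightarrow> bool pmf"
    and M \<delta> :: real
  assumes sp: "\<And>z. z \<in> U \<Longrightarrow> set_pmf (p z) \<subseteq> {1..n}"
    and pp: "\<And>z i. z \<in> U \<Longrightarrow> i \<in> {1..n} \<Longrightarrow> pmf (p z) i = Pb i + X z * d i + W z * e i"
    and Pb: "(\<Sum>i=1..n. \<bar>Pb i\<bar>) \<le> 1" and de: "(\<Sum>i=1..n. \<bar>d i\<bar>) \<le> 4" "(\<Sum>i=1..n. \<bar>e i\<bar>) \<le> 2"
    and M: "M \<ge> 0" "\<delta> \<ge> 0"
    and b0: "\<And>i. i \<in> {1..n} \<Longrightarrow> \<bar>\<Sum>z\<in>U. c z * (X z ^ a * W z ^ b * pmf (r z i) True)\<bar> \<le> M"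
    and b1: "\<And>i. i \<in> {1..n} \<Longrightarrow> \<bar>\<Sum>z\<in>U. c z * (X z ^ Suc a * W z ^ b * pmf (r z i) True)\<bar> \<le> \<delta> * M"
    and b2: "\<And>i. i \<in> {1..n} \<Longrightarrow> \<bar>\<Sum>z\<in>U. c z * (X z ^ a * W z ^ Suc b * pmf (r z i) True)\<bar> \<le> \<delta> * M"
  shows "\<bar>\<Sum>z\<in>U. c z * (X z ^ a * W z ^ b * pmf (bind_pmf (p z) (r z)) True)\<bar> \<le> M * (1 + 6 * \<delta>)"
proof -
  let ?T = "\<lambda>a b i. \<Sum>z\<in>U. c z * (X z ^ a * W z ^ b * pmf (r z i) True)"
  have "(\<Sum>z\<in>U. c z * (X z ^ a * W z ^ b * pmf (bind_pmf (p z) (r z)) True))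
    = (\<Sum>z\<in>U. \<Sum>i=1..n. Pb i * (c z * (X z ^ a * W z ^ b * pmf (r z i) True))
        + d i * (c z * (X z ^ Suc a * W z ^ b * pmf (r z i) True))
        + e i * (c z * (X z ^ a * W z ^ Suc b * pmf (r z i) True)))"
    by (intro sum.cong refl)
       (simp add: pmf_bind_finite_support[OF sp] pp sum_distrib_left algebra_simps)
  also have "\<dots> = (\<Sum>i=1..n. Pb i * ?T a b i + d i * ?T (Suc a) b i + e i * ?T a (Suc b) i)"
    by (subst sum.swap) (simp add: sum.distrib sum_distrib_left)
  finally have eq: "(\<Sum>z\<in>U. c z * (X z ^ a * W z ^ b * pmf (bind_pmf (p z) (r z)) True)) = \<dots>" .
  have "\<bar>\<Sum>i=1..n. Pb i * ?T a b i + d i * ?T (Suc a) b i + e i * ?T a (Suc b) i\<bar>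
      \<le> (\<Sum>i=1..n. \<bar>Pb i\<bar> * M + \<bar>d i\<bar> * (\<delta> * M) + \<bar>e i\<bar> * (\<delta> * M))"
  proof (rule order_trans[OF sum_abs], rule sum_mono)
    fix i assume i: "i \<in> {1..n}"
    have "\<bar>Pb i * ?T a b i\<bar> \<le> \<bar>Pb i\<bar> * M" "\<bar>d i * ?T (Suc a) b i\<bar> \<le> \<bar>d i\<bar> * (\<delta> * M)"
         "\<bar>e i * ?T a (Suc b) i\<bar> \<le> \<bar>e i\<bar> * (\<delta> * M)"
      unfolding abs_mult using b0[OF i] b1[OF i] b2[OF i] by (intro mult_left_mono; simp)+
    thus "\<bar>Pb i * ?T a b i + d i * ?T (Suc a) b i + e i * ?T a (Suc b) i\<bar>
       \<le> \<bar>Pb i\<bar> * M + \<bar>d i\<bar> * (\<delta> * M) + \<bar>e i\<bar> * (\<delta> * M)"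
      by linarith
  qed
  also have "\<dots> = (\<Sum>i=1..n. \<bar>Pb i\<bar>) * M + (\<Sum>i=1..n. \<bar>d i\<bar>) * (\<delta> * M) + (\<Sum>i=1..n. \<bar>e i\<bar>) * (\<delta> * M)"
    by (simp only: sum.distrib sum_distrib_right)
  also have "\<dots> \<le> 1 * M + 4 * (\<delta> * M) + 2 * (\<delta> * M)"
    using Pb de M by (intro add_mono mult_right_mono) auto
  finally show ?thesis unfolding eq by (simp add: algebra_simps)
qed

text \<open>
  Drawing a sample multiplies by an affine function of \<open>(X, W)\<close>, hence either keeps the degree
  \<open>a + b\<close> of the monomial prefactor or raises it by one; prefactors of degree at most \<open>L\<close>
  integrate to zero at the leaves of the tester.
\<close>

lemma run_signed_mixture_bound:
  fixes X W c :: "'z \<Rightarrow> real" and p q :: "'z \<Rightarrow> nat pmf" and B \<rho> :: real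
  assumes fin: "finite U" and c: "(\<Sum>z\<in>U. \<bar>c z\<bar>) \<le> 2"
    and bnd: "\<And>z. z \<in> U \<Longrightarrow> \<bar>X z\<bar> \<le> B" "\<And>z. z \<in> U \<Longrightarrow> \<bar>W z\<bar> \<le> B"
    and mom: "\<And>a b. a + b \<le> L \<Longrightarrow> (\<Sum>z\<in>U. c z * (X z ^ a * W z ^ b)) = 0"
    and sp: "\<And>z. z \<in> U \<Longrightarrow> set_pmf (p z) \<subseteq> {1..n}"
    and pp: "\<And>z i. z \<in> U \<Longrightarrow> i \<in> {1..n} \<Longrightarrow> pmf (p z) i = Pb i + X z * d i + W z * e i"
    and Pb: "(\<Sum>i=1..n. \<bar>Pb i\<bar>) \<le> 1" "(\<Sum>i=1..n. \<bar>d i\<bar>) \<le> 4" "(\<Sum>i=1..n. \<bar>e i\<bar>) \<le> 2"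
    and sq: "\<And>z. z \<in> U \<Longrightarrow> set_pmf (q z) \<subseteq> {1..n}"
    and qq: "\<And>z i. z \<in> U \<Longrightarrow> i \<in> {1..n} \<Longrightarrow> pmf (q z) i = Qb i + X z * d' i + W z * e' i"
    and Qb: "(\<Sum>i=1..n. \<bar>Qb i\<bar>) \<le> 1" "(\<Sum>i=1..n. \<bar>d' i\<bar>) \<le> 4" "(\<Sum>i=1..n. \<bar>e' i\<bar>) \<le> 2"
    and \<rho>: "\<rho> \<ge> 1" and B: "B \<ge> 0"
    and sc: "sample_complexity n A \<le> enat k"
  shows "\<bar>\<Sum>z\<in>U. c z * (X z ^ a * W z ^ b * pmf (run (p z) (q z) A) True)\<bar>
     \<le> 2 * (\<rho> * B) ^ (a + b) / \<rho> ^ Suc L * (1 + 6 * (\<rho> * B)) ^ k"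
  using sc
proof (induction A arbitrary: k a b)
  case (Answer x)
  have le: "\<bar>\<Sum>z\<in>U. c z * (X z ^ a * W z ^ b)\<bar> \<le> 2 * (\<rho> * B) ^ (a + b) / \<rho> ^ Suc L"
  proof (cases "a + b \<le> L")
    case True
    thus ?thesis using mom \<rho> B by simp
  next
    case False
    have "\<bar>c z * (X z ^ a * W z ^ b)\<bar> \<le> \<bar>c z\<bar> * B ^ (a + b)" if "z \<in> U" for z
      unfolding abs_mult power_abs power_add using bnd[OF that] B
      by (intro mult_left_mono mult_mono power_mono) auto
    hence "\<bar>\<Sum>z\<in>U. c z * (X z ^ a * W z ^ b)\<bar> \<le> (\<Sum>z\<in>U. \<bar>c z\<bar> * B ^ (a + b))"
      by (intro order_trans[OF sum_abs] sum_mono)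
    also have "\<dots> \<le> 2 * B ^ (a + b)"
      unfolding sum_distrib_right[symmetric] using c B by (intro mult_right_mono) auto
    \<comment> \<open>Beyond degree \<open>L\<close> the moments need not cancel, but then the
      inserted quotient is at least 1. This brings both cases under one bound, geometric in the
      degree with ratio \<open>\<rho> * B\<close>.\<close>
    also have "\<dots> \<le> 2 * B ^ (a + b) * (\<rho> ^ (a + b) / \<rho> ^ Suc L)"
    proof -
      have "\<rho> ^ Suc L \<le> \<rho> ^ (a + b)"
        using False \<rho> by (intro power_increasing) auto
      hence "1 \<le> \<rho> ^ (a + b) / \<rho> ^ Suc L" using \<rho> by simp
      from mult_left_mono[OF this, of "2 * B ^ (a + b)"] show ?thesis using B by simp
    qed
    finally show ?thesis by (simp add: power_mult_distrib mult_ac)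
  qed
  have "\<bar>\<Sum>z\<in>U. c z * (X z ^ a * W z ^ b * pmf (run (p z) (q z) (Answer x)) True)\<bar>
      \<le> \<bar>\<Sum>z\<in>U. c z * (X z ^ a * W z ^ b)\<bar>"
    by (cases x) simp_all
  also note le
  also have "2 * (\<rho> * B) ^ (a + b) / \<rho> ^ Suc L
     \<le> 2 * (\<rho> * B) ^ (a + b) / \<rho> ^ Suc L * (1 + 6 * (\<rho> * B)) ^ k"
  proof -
    have "1 \<le> (1 + 6 * (\<rho> * B)) ^ k" using \<rho> B by (intro one_le_power) auto
    from mult_left_mono[OF this, of "2 * (\<rho> * B) ^ (a + b) / \<rho> ^ Suc L"] show ?thesis
      using \<rho> B by simp
  qed
  finally show ?case .
next
  case (Randomize R)
  let ?M = "2 * (\<rho> * B) ^ (a + b) / \<rho> ^ Suc L * (1 + 6 * (\<rho> * B)) ^ k"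
  let ?h = "\<lambda>z A. pmf (run (p z) (q z) A) True"
  have int: "integrable (measure_pmf R) (?h z)" for z
    by (rule measure_pmf.integrable_const_bound[where B = 1]) (auto simp: pmf_le_1)
  have "pmf (run (p z) (q z) (Randomize R)) True = (\<integral>A. ?h z A \<partial>measure_pmf R)" for z
    by (simp add: bind_eq_join_pmf[symmetric] pmf_bind)
  hence "(\<Sum>z\<in>U. c z * (X z ^ a * W z ^ b * pmf (run (p z) (q z) (Randomize R)) True))
     = (\<integral>A. (\<Sum>z\<in>U. c z * (X z ^ a * W z ^ b * ?h z A)) \<partial>measure_pmf R)"
    using int by (subst Bochner_Integration.integral_sum) auto
  also have "\<bar>\<dots>\<bar> \<le> (\<integral>A. \<bar>\<Sum>z\<in>U. c z * (X z ^ a * W z ^ b * ?h z A)\<bar> \<partial>measure_pmf R)"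
    by (rule integral_abs_bound)
  also have "\<dots> \<le> (\<integral>A. ?M \<partial>measure_pmf R)"
  proof (rule integral_mono_AE)
    show "integrable (measure_pmf R) (\<lambda>A. \<bar>\<Sum>z\<in>U. c z * (X z ^ a * W z ^ b * ?h z A)\<bar>)"
      using int by (intro integrable_abs Bochner_Integration.integrable_sum) auto
    show "AE A in measure_pmf R. \<bar>\<Sum>z\<in>U. c z * (X z ^ a * W z ^ b * ?h z A)\<bar> \<le> ?M"
      unfolding AE_measure_pmf_iff
      using Randomize.IH sample_complexity_RandomizeD[OF Randomize.prems] by blast
  qed simp
  finally show ?case by simp
next
  case (Sample_p f)
  from Sample_p.prems obtain k' where k: "k = Suc k'" "\<And>i. i \<in> {1..n} \<Longrightarrow> sample_complexity n (f i) \<le> enat k'"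
    by (auto elim: eSuc_SUP_leE)
  have IH: "\<bar>\<Sum>z\<in>U. c z * (X z ^ a * W z ^ b * pmf (run (p z) (q z) (f i)) True)\<bar>
     \<le> 2 * (\<rho> * B) ^ (a + b) / \<rho> ^ Suc L * (1 + 6 * (\<rho> * B)) ^ k'" if "i \<in> {1..n}" for i a b
    using Sample_p.IH[OF _ k(2)[OF that]] by simp
  \<comment> \<open>Raising the degree of the prefactor by one multiplies the inductive bound by
    \<open>\<rho> * B\<close>, which is therefore the choice of \<open>\<delta>\<close>.\<close>
  show ?case unfolding run.simps
    by (rule order_trans[OF perturbed_sample_step[OF sp pp Pb, where \<delta> = "\<rho> * B"
         and M = "2 * (\<rho> * B) ^ (a + b) / \<rho> ^ Suc L * (1 + 6 * (\<rho> * B)) ^ k'"]])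
       (use IH[of _ a b] IH[of _ "Suc a" b] IH[of _ a "Suc b"] \<rho> B in \<open>auto simp: k(1) mult_ac\<close>)
next
  case (Sample_q f)
  from Sample_q.prems obtain k' where k: "k = Suc k'" "\<And>i. i \<in> {1..n} \<Longrightarrow> sample_complexity n (f i) \<le> enat k'"
    by (auto elim: eSuc_SUP_leE)
  have IH: "\<bar>\<Sum>z\<in>U. c z * (X z ^ a * W z ^ b * pmf (run (p z) (q z) (f i)) True)\<bar>
     \<le> 2 * (\<rho> * B) ^ (a + b) / \<rho> ^ Suc L * (1 + 6 * (\<rho> * B)) ^ k'" if "i \<in> {1..n}" for i a b
    using Sample_q.IH[OF _ k(2)[OF that]] by simp
  show ?case unfolding run.simps
    by (rule order_trans[OF perturbed_sample_step[OF sq qq Qb, where \<delta> = "\<rho> * B"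
         and M = "2 * (\<rho> * B) ^ (a + b) / \<rho> ^ Suc L * (1 + 6 * (\<rho> * B)) ^ k'"]])
       (use IH[of _ a b] IH[of _ "Suc a" b] IH[of _ a "Suc b"] \<rho> B in \<open>auto simp: k(1) mult_ac\<close>)
qed

section \<open>Distributions built from independent sites\<close>

text \<open>
  Site \<open>r\<close> with parameters \<open>(x, w)\<close> consists of the elements \<open>2 r + 1\<close> and \<open>2 r + 2\<close>, of masses
  \<open>x + s w\<close> and \<open>x - s w\<close>; the sign \<open>s\<close> is \<open>1\<close> for \<open>p\<close> and \<open>-1\<close> for \<open>q\<close>. The remaining mass goes
  to the element \<open>2 N + 1\<close>, hence is the same for \<open>p\<close> and \<open>q\<close>.
\<close>

definition site_mass :: "nat \<Rightarrow> real \<Rightarrow> (nat \<Rightarrow> real \<times> real) \<Rightarrow> nat \<Rightarrow> real" where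
  "site_mass N s z i =
     (if i = 0 \<or> i > 2 * N + 1 then 0
      else if i = 2 * N + 1 then 1 - 2 * (\<Sum>r<N. fst (z r))
      else if odd i then fst (z (i div 2)) + s * snd (z (i div 2))
      else fst (z ((i - 1) div 2)) - s * snd (z ((i - 1) div 2)))"

definition site_pmf :: "nat \<Rightarrow> real \<Rightarrow> (nat \<Rightarrow> real \<times> real) \<Rightarrow> nat pmf" where
  "site_pmf N s z = embed_pmf (site_mass N s z)"

text \<open>Makes all masses nonnegative for both signs \<open>s\<close>: the first condition on the
  pairs, the second on the remaining element.\<close>

definition site_valid :: "nat \<Rightarrow> (nat \<Rightarrow> real \<times> real) \<Rightarrow> bool" where
  "site_valid N z \<longleftrightarrow> (\<forall>r<N. \<bar>snd (z r)\<bar> \<le> fst (z r)) \<and> 2 * (\<Sum>r<N. fst (z r)) \<le> 1"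

lemma site_mass_simps:
  "r < N \<Longrightarrow> site_mass N s z (2 * r + 1) = fst (z r) + s * snd (z r)"
  "r < N \<Longrightarrow> site_mass N s z (2 * r + 2) = fst (z r) - s * snd (z r)"
  "site_mass N s z (2 * N + 1) = 1 - 2 * (\<Sum>r<N. fst (z r))"
  by (auto simp: site_mass_def)

lemma sum_over_sites:
  fixes f :: "nat \<Rightarrow> 'a :: comm_monoid_add"
  assumes "2 * N + 1 \<le> n" "\<And>i. i > 2 * N + 1 \<Longrightarrow> f i = 0"
  shows "(\<Sum>i=1..n. f i) = (\<Sum>r<N. f (2 * r + 1) + f (2 * r + 2)) + f (2 * N + 1)"
proof -
  have "(\<Sum>i=1..n. f i) = (\<Sum>i=1..2*N+1. f i)"
    using assms by (intro sum.mono_neutral_right) auto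
  also have "\<dots> = (\<Sum>r<N. f (2 * r + 1) + f (2 * r + 2)) + f (2 * N + 1)"
  proof (induction N)
    case (Suc N)
    have "{1..2 * Suc N + 1} = {1..2 * N + 1} \<union> {2 * N + 2, 2 * N + 3}" by auto
    hence "(\<Sum>i=1..2 * Suc N + 1. f i) = (\<Sum>i=1..2 * N + 1. f i) + (f (2 * N + 2) + f (2 * N + 3))"
      by (simp add: sum.union_disjoint add_ac)
    thus ?case using Suc by (simp add: add_ac eval_nat_numeral)
  qed simp
  finally show ?thesis .
qed

lemma site_index_cases:
  fixes i N :: nat
  assumes "i \<in> {1..2 * N + 1}"
  obtains r where "r < N" "i = 2 * r + 1" | r where "r < N" "i = 2 * r + 2" | "i = 2 * N + 1"
proof (cases "i = 2 * N + 1")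
  case False
  show ?thesis
  proof (cases "odd i")
    case True
    then obtain r where "i = 2 * r + 1" by (auto elim: oddE)
    thus ?thesis using that(1)[of r] assms False by auto
  next
    case even: False
    then obtain r where r: "i = 2 * r" by (auto elim: evenE)
    then obtain r' where "r = Suc r'" using assms by (cases r) auto
    thus ?thesis using that(2)[of r'] r assms by auto
  qed
qed (use that in auto)

lemma site_mass_nonneg:
  assumes "site_valid N z" "\<bar>s\<bar> = 1"
  shows "site_mass N s z i \<ge> 0"
proof (cases "i \<in> {1..2 * N + 1}")
  case True
  have w: "\<bar>s * snd (z r)\<bar> \<le> fst (z r)" if "r < N" for r
    using assms that by (simp add: site_valid_def abs_mult)
  from True show ?thesis
  proof (cases rule: site_index_cases)
    case (1 r)
    show ?thesis using w[OF 1(1)] unfolding 1(2) site_mass_simps(1)[OF 1(1)] by linarith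
  next
    case (2 r)
    show ?thesis using w[OF 2(1)] unfolding 2(2) site_mass_simps(2)[OF 2(1)] by linarith
  next
    case 3
    show ?thesis using assms(1) unfolding 3 site_mass_simps(3) site_valid_def by linarith
  qed
qed (auto simp: site_mass_def)

lemma sum_site_mass:
  assumes "2 * N + 1 \<le> n"
  shows "(\<Sum>i=1..n. site_mass N s z i) = 1"
proof -
  have "(\<Sum>i=1..n. site_mass N s z i) =
      (\<Sum>r<N. site_mass N s z (2 * r + 1) + site_mass N s z (2 * r + 2)) + site_mass N s z (2 * N + 1)"
    using assms by (rule sum_over_sites) (simp add: site_mass_def)
  also have "(\<Sum>r<N. site_mass N s z (2 * r + 1) + site_mass N s z (2 * r + 2)) = (\<Sum>r<N. 2 * fst (z r))"
  proof (rule sum.cong)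
    fix r assume "r \<in> {..<N}"
    hence r: "r < N" by simp
    show "site_mass N s z (2 * r + 1) + site_mass N s z (2 * r + 2) = 2 * fst (z r)"
      unfolding site_mass_simps(1,2)[OF r] by simp
  qed simp
  finally show ?thesis by (simp only: site_mass_simps sum_distrib_left[symmetric])
qed

lemma pmf_site_pmf:
  assumes "site_valid N z" "\<bar>s\<bar> = 1"
  shows "pmf (site_pmf N s z) i = site_mass N s z i"
  unfolding site_pmf_def
proof (rule pmf_embed_pmf)
  show "site_mass N s z i \<ge> 0" for i using site_mass_nonneg[OF assms] .
  have "(\<integral>\<^sup>+i. ennreal (site_mass N s z i) \<partial>count_space UNIV) = (\<Sum>i=1..2*N+1. ennreal (site_mass N s z i))"
    by (subst nn_integral_count_space'[of "{1..2*N+1}"]) (auto simp: site_mass_def)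
  also have "\<dots> = ennreal (\<Sum>i=1..2*N+1. site_mass N s z i)"
    by (intro sum_ennreal site_mass_nonneg[OF assms])
  also have "\<dots> = 1" by (subst sum_site_mass) auto
  finally show "(\<integral>\<^sup>+i. ennreal (site_mass N s z i) \<partial>count_space UNIV) = 1" .
qed

lemma site_pmf_in_dists:
  assumes "site_valid N z" "\<bar>s\<bar> = 1" "2 * N + 1 \<le> n"
  shows "site_pmf N s z \<in> dists n"
  using assms(3) by (auto simp: dists_def set_pmf_eq pmf_site_pmf[OF assms(1,2)] site_mass_def split: if_splits)

text \<open>The masses are affine in the parameters of any single site; the coefficient
  \<open>- 2\<close> is the mass withdrawn from the remaining element. For \<open>s\<close> of
  modulus 1 the coefficient vectors have absolute sums 4 and 2, as
  \<open>run_signed_mixture_bound\<close> requires.\<close>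

lemma site_mass_update:
  assumes "r < N"
  shows "site_mass N s (z(r := v)) i = site_mass N s (z(r := (0, 0))) i
     + fst v * (if i = 2 * r + 1 \<or> i = 2 * r + 2 then 1 else if i = 2 * N + 1 then - 2 else 0)
     + snd v * (if i = 2 * r + 1 then s else if i = 2 * r + 2 then - s else 0)"
proof (cases "i \<in> {1..2 * N + 1}")
  case True
  thus ?thesis
  proof (cases rule: site_index_cases)
    case (1 r')
    have "2 * r' + 1 \<noteq> 2 * r + 2" "2 * r' + 2 \<noteq> 2 * r + 1" "2 * r' + 2 \<noteq> 2 * N + 1" by presburger+
    thus ?thesis unfolding 1(2) site_mass_simps(1)[OF 1(1)] using 1(1)
      by (cases "r' = r") (simp_all add: algebra_simps)
  next
    case (2 r')
    have "2 * r' + 1 \<noteq> 2 * r + 2" "2 * r' + 2 \<noteq> 2 * r + 1" "2 * r' + 2 \<noteq> 2 * N + 1" by presburger+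
    thus ?thesis unfolding 2(2) site_mass_simps(2)[OF 2(1)] using 2(1)
      by (cases "r' = r") (simp_all add: algebra_simps)
  next
    case 3
    have "(\<Sum>r'<N. fst ((z(r := v)) r')) = fst v + (\<Sum>r'<N. fst ((z(r := (0,0))) r'))"
      using assms by (simp add: sum.remove[of "{..<N}" r])
    moreover have "2 * N + 1 \<noteq> 2 * r + 1" "2 * N + 1 \<noteq> 2 * r + 2" using assms by presburger+
    ultimately show ?thesis unfolding 3 site_mass_simps(3) by simp
  qed
next
  case False
  thus ?thesis using assms by (auto simp: site_mass_def)
qed

section \<open>Replacing one site law by another\<close>

text \<open>The value 0 is a default for sites of total mass above 1, where the mass of the
  remaining element would be negative. The function thus takes values in [0, 1] for all parameters
  and can be averaged over product laws.\<close>

definition site_accept :: "nat \<Rightarrow> tester \<Rightarrow> (nat \<Rightarrow> real \<times> real) \<Rightarrow> real" where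
  "site_accept N A z =
     (if 2 * (\<Sum>r<N. fst (z r)) \<le> 1 then pmf (run (site_pmf N 1 z) (site_pmf N (-1) z) A) True else 0)"

lemma site_accept_bounds: "0 \<le> site_accept N A z" "site_accept N A z \<le> 1"
  by (auto simp: site_accept_def pmf_le_1)

lemma expectation_diff_finite:
  fixes f :: "'a \<Rightarrow> real"
  assumes "finite (set_pmf D0)" "finite (set_pmf D1)"
  shows "measure_pmf.expectation D1 f - measure_pmf.expectation D0 f
     = (\<Sum>v\<in>set_pmf D0 \<union> set_pmf D1. (pmf D1 v - pmf D0 v) * f v)"
  by (subst (1 2) integral_measure_pmf[of "set_pmf D0 \<union> set_pmf D1"])
     (use assms in \<open>auto simp: sum_subtractf left_diff_distrib\<close>)

lemma sum_abs_diff_pmf_le: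
  assumes "finite U"
  shows "(\<Sum>v\<in>U. \<bar>pmf D1 v - pmf D0 v\<bar>) \<le> 2"
proof -
  have "(\<Sum>v\<in>U. \<bar>pmf D1 v - pmf D0 v\<bar>) \<le> (\<Sum>v\<in>U. pmf D1 v + pmf D0 v)"
    by (intro sum_mono) (smt (verit) pmf_nonneg)
  also have "\<dots> = measure_pmf.prob D1 U + measure_pmf.prob D0 U"
    using assms by (simp add: sum.distrib measure_measure_pmf_finite)
  also have "\<dots> \<le> 1 + 1" by (intro add_mono measure_pmf.prob_le_1)
  finally show ?thesis by simp
qed

text \<open>The bound on the means keeps the expected total mass of the \<open>N\<close> pairs at
  most 1/4, which leaves room for a tail bound at a level near 1.\<close>

locale matching_sites =
  fixes D0 D1 :: "(real \<times> real) pmf" and B :: real and L :: nat and n N :: nat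
  assumes finite_D: "finite (set_pmf D0)" "finite (set_pmf D1)"
    and support_D: "\<And>v. v \<in> set_pmf D0 \<union> set_pmf D1 \<Longrightarrow> \<bar>snd v\<bar> \<le> fst v \<and> fst v \<le> B"
    and moments: "\<And>a b. a + b \<le> L \<Longrightarrow> measure_pmf.expectation D0 (\<lambda>v. fst v ^ a * snd v ^ b)
        = measure_pmf.expectation D1 (\<lambda>v. fst v ^ a * snd v ^ b)"
    and N_le: "2 * N + 1 \<le> n" and N_pos: "N > 0" and B_pos: "B > 0"
    and mean_D: "measure_pmf.expectation D0 fst \<le> 1 / (8 * N)" "measure_pmf.expectation D1 fst \<le> 1 / (8 * N)"
begin

text \<open>With all other sites fixed, \<open>run_signed_mixture_bound\<close> applies to the
  signed weights \<open>pmf D1 v - pmf D0 v\<close> with the constant prefactor 1. The hypothesis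
  \<open>mass\<close> leaves room \<open>2 * B\<close> for site \<open>r\<close>, so every value in
  the supports gives genuine distributions.\<close>

lemma site_replacement_bound:
  assumes r: "r < N"
    and z: "\<And>r'. r' < N \<Longrightarrow> r' \<noteq> r \<Longrightarrow> \<bar>snd (z r')\<bar> \<le> fst (z r')"
    and mass: "2 * (\<Sum>r'\<in>{..<N} - {r}. fst (z r')) \<le> 1 - 2 * B"
    and sc: "sample_complexity n A \<le> enat k" and \<rho>: "\<rho> \<ge> 1"
  shows "\<bar>measure_pmf.expectation D1 (\<lambda>v. site_accept N A (z(r := v)))
       - measure_pmf.expectation D0 (\<lambda>v. site_accept N A (z(r := v)))\<bar>
      \<le> 2 / \<rho> ^ Suc L * (1 + 6 * (\<rho> * B)) ^ k"
proof -
  let ?U = "set_pmf D0 \<union> set_pmf D1" and ?z0 = "z(r := (0, 0))"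
  let ?c = "\<lambda>v. pmf D1 v - pmf D0 v"
  have sum_upd: "(\<Sum>r'<N. fst ((z(r := v)) r')) = fst v + (\<Sum>r'\<in>{..<N} - {r}. fst (z r'))" for v
    using r by (simp add: sum.remove[of "{..<N}" r])
  have valid: "site_valid N (z(r := v))" if "\<bar>snd v\<bar> \<le> fst v" "fst v \<le> B" for v
    unfolding site_valid_def sum_upd using that z mass by auto
  have validU: "site_valid N (z(r := v))" if "v \<in> ?U" for v
    using support_D[OF that] by (intro valid) auto
  have valid0: "site_valid N ?z0" by (rule valid) (use B_pos in auto)
  have acc: "site_accept N A (z(r := v))
      = pmf (run (site_pmf N 1 (z(r := v))) (site_pmf N (-1) (z(r := v))) A) True" if "v \<in> ?U" for v
    using validU[OF that] unfolding site_valid_def site_accept_def by presburger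
  let ?d = "\<lambda>i. if i = 2 * r + 1 \<or> i = 2 * r + 2 then 1 else if i = 2 * N + 1 then - 2 else 0 :: real"
  let ?e = "\<lambda>s i. if i = 2 * r + 1 then s else if i = 2 * r + 2 then - s else 0 :: real"
  have sub: "{2 * r + 1, 2 * r + 2, 2 * N + 1} \<subseteq> {1..n}" using r N_le by auto
  have ne: "2 * N + 1 \<noteq> 2 * r + 1" "2 * N + 1 \<noteq> 2 * r + 2" using r by presburger+
  have "(\<Sum>i=1..n. \<bar>?d i\<bar>) = (\<Sum>i\<in>{2 * r + 1, 2 * r + 2, 2 * N + 1}. \<bar>?d i\<bar>)"
    using sub by (intro sum.mono_neutral_right) auto
  also have "\<dots> = 4" using ne by simp
  finally have d: "(\<Sum>i=1..n. \<bar>?d i\<bar>) \<le> 4" by simp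
  have e: "(\<Sum>i=1..n. \<bar>?e s i\<bar>) \<le> 2" if "\<bar>s\<bar> = 1" for s
  proof -
    have "(\<Sum>i=1..n. \<bar>?e s i\<bar>) = (\<Sum>i\<in>{2 * r + 1, 2 * r + 2}. \<bar>?e s i\<bar>)"
      using sub by (intro sum.mono_neutral_right) auto
    thus ?thesis using that by simp
  qed
  have base: "(\<Sum>i=1..n. \<bar>site_mass N s ?z0 i\<bar>) \<le> 1" if "\<bar>s\<bar> = 1" for s
    using sum_site_mass[OF N_le, of s ?z0] site_mass_nonneg[OF valid0 that] by simp
  have P: "pmf (site_pmf N s (z(r := v))) i = site_mass N s ?z0 i + fst v * ?d i + snd v * ?e s i"
    if "v \<in> ?U" "\<bar>s\<bar> = 1" for v s i
    unfolding pmf_site_pmf[OF validU[OF that(1)] that(2)] by (rule site_mass_update[OF r])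
  have S: "set_pmf (site_pmf N s (z(r := v))) \<subseteq> {1..n}" if "v \<in> ?U" "\<bar>s\<bar> = 1" for v s
    using site_pmf_in_dists[OF validU[OF that(1)] that(2) N_le] by (simp add: dists_def)
  have mom: "(\<Sum>v\<in>?U. ?c v * (fst v ^ a * snd v ^ b)) = 0" if "a + b \<le> L" for a b
    using moments[OF that] expectation_diff_finite[OF finite_D, of "\<lambda>v. fst v ^ a * snd v ^ b"] by simp
  have "\<bar>\<Sum>v\<in>?U. ?c v * (fst v ^ 0 * snd v ^ 0 *
        pmf (run (site_pmf N 1 (z(r := v))) (site_pmf N (-1) (z(r := v))) A) True)\<bar>
     \<le> 2 * (\<rho> * B) ^ (0 + 0) / \<rho> ^ Suc L * (1 + 6 * (\<rho> * B)) ^ k"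
  proof (rule run_signed_mixture_bound[where Pb = "site_mass N 1 ?z0" and d = ?d and e = "?e 1"
        and Qb = "site_mass N (-1) ?z0" and d' = ?d and e' = "?e (-1)"])
    show "(\<Sum>v\<in>?U. \<bar>?c v\<bar>) \<le> 2" using finite_D by (intro sum_abs_diff_pmf_le) auto
    show "\<bar>fst v\<bar> \<le> B" "\<bar>snd v\<bar> \<le> B" if "v \<in> ?U" for v
      using support_D[OF that] by linarith+
  qed (use finite_D mom P S base d e B_pos \<rho> sc in \<open>auto simp del: Un_iff\<close>)
  moreover have "(\<Sum>v\<in>?U. ?c v * (fst v ^ 0 * snd v ^ 0 *
        pmf (run (site_pmf N 1 (z(r := v))) (site_pmf N (-1) (z(r := v))) A) True))
      = (\<Sum>v\<in>?U. ?c v * site_accept N A (z(r := v)))"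
    by (intro sum.cong refl) (simp only: acc power_0 mult_1)
  ultimately have "\<bar>\<Sum>v\<in>?U. ?c v * site_accept N A (z(r := v))\<bar> \<le> 2 / \<rho> ^ Suc L * (1 + 6 * (\<rho> * B)) ^ k"
    by simp
  thus ?thesis using expectation_diff_finite[OF finite_D] by simp
qed

text \<open>The hybrids of the replacement argument; coordinates outside \<open>R\<close> take the
  default \<open>(0, 0)\<close>, a site of mass 0.\<close>

definition mixed :: "nat set \<Rightarrow> nat set \<Rightarrow> (nat \<Rightarrow> real \<times> real) pmf" where
  "mixed R H = Pi_pmf R (0, 0) (\<lambda>r. if r \<in> H then D1 else D0)"

lemma finite_set_mixed: "finite R \<Longrightarrow> finite (set_pmf (mixed R H))"
  unfolding mixed_def by (subst set_Pi_pmf) (auto simp: finite_D intro!: finite_PiE_dflt)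

lemma mixed_support:
  assumes "finite R" "z \<in> set_pmf (mixed R H)" "r \<in> R"
  shows "\<bar>snd (z r)\<bar> \<le> fst (z r)" "fst (z r) \<le> B"
proof -
  have "z r \<in> set_pmf D0 \<union> set_pmf D1"
    using assms unfolding mixed_def by (auto simp: set_Pi_pmf PiE_dflt_def split: if_splits)
  from support_D[OF this] show "\<bar>snd (z r)\<bar> \<le> fst (z r)" "fst (z r) \<le> B" by auto
qed

section \<open>Tail bound for the total mass of the sites\<close>

text \<open>By independence the expectation factorizes. On [0, 1] the inequality exp u \<le> 1 + 2 u
  holds, so the bound on the mean gives at most \<open>exp (1 / (4 * B * N))\<close> per site, and
  there are at most \<open>N\<close> sites.\<close>

lemma expectation_exp_mass:
  assumes R: "R \<subseteq> {..<N}"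
  shows "measure_pmf.expectation (mixed R H) (\<lambda>z. exp ((\<Sum>r\<in>R. fst (z r)) / B)) \<le> exp (1 / (4 * B))"
proof -
  have fin: "finite R" using R finite_subset by blast
  have E: "measure_pmf.expectation D (\<lambda>v. exp (fst v / B)) \<le> exp (1 / (4 * B * N))"
    if D: "D = D0 \<or> D = D1" for D
  proof -
    have finD: "finite (set_pmf D)" using D finite_D by auto
    have sup: "0 \<le> fst v" "fst v \<le> B" if "v \<in> set_pmf D" for v
      using support_D[of v] that D by auto
    have "measure_pmf.expectation D (\<lambda>v. exp (fst v / B)) \<le> measure_pmf.expectation D (\<lambda>v. 1 + 2 / B * fst v)"
    proof (rule integral_mono_AE)
      show "AE v in measure_pmf D. exp (fst v / B) \<le> 1 + 2 / B * fst v"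
        unfolding AE_measure_pmf_iff
      proof
        fix v assume v: "v \<in> set_pmf D"
        define u where "u = fst v / B"
        have u: "0 \<le> u" "u \<le> 1" using sup[OF v] B_pos by (auto simp: u_def)
        have "exp u \<le> 1 + u + u\<^sup>2" using u by (intro exp_bound) auto
        also have "u\<^sup>2 \<le> u" using u by (simp add: power2_eq_square mult_left_le)
        finally show "exp (fst v / B) \<le> 1 + 2 / B * fst v" by (simp add: u_def)
      qed
    qed (use finD in \<open>auto intro: integrable_measure_pmf_finite\<close>)
    also have "\<dots> = 1 + 2 / B * measure_pmf.expectation D fst"
      using finD by (subst Bochner_Integration.integral_add)
        (auto intro: integrable_measure_pmf_finite)
    also have "\<dots> \<le> 1 + 2 / B * (1 / (8 * N))"
      using mean_D D B_pos by (intro add_left_mono mult_left_mono) auto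
    also have "\<dots> \<le> exp (2 / B * (1 / (8 * N)))" by (rule exp_ge_add_one_self)
    also have "2 / B * (1 / (8 * N)) = 1 / (4 * B * N)" by simp
    finally show ?thesis .
  qed
  have "measure_pmf.expectation (mixed R H) (\<lambda>z. exp ((\<Sum>r\<in>R. fst (z r)) / B))
     = measure_pmf.expectation (mixed R H) (\<lambda>z. \<Prod>r\<in>R. exp (fst (z r) / B))"
    using fin by (simp add: exp_sum sum_divide_distrib)
  also have "\<dots> = (\<Prod>r\<in>R. measure_pmf.expectation (if r \<in> H then D1 else D0) (\<lambda>v. exp (fst v / B)))"
    unfolding mixed_def using fin finite_D
    by (intro expectation_prod_Pi_pmf) (auto intro: integrable_measure_pmf_finite)
  also have "\<dots> \<le> (\<Prod>r\<in>R. exp (1 / (4 * B * N)))"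
    by (intro prod_mono conjI E integral_nonneg) auto
  also have "\<dots> = exp (card R * (1 / (4 * B * N)))" by (simp add: exp_of_nat_mult[symmetric])
  also have "\<dots> \<le> exp (N * (1 / (4 * B * N)))"
    using card_mono[OF _ R] B_pos by (subst exp_le_cancel_iff, intro mult_right_mono) auto
  also have "N * (1 / (4 * B * N)) = 1 / (4 * B)" using N_pos by simp
  finally show ?thesis .
qed

text \<open>A Chernoff bound with rate \<open>1 / B\<close>: the threshold contributes
  \<open>exp (1 - 1 / (2 * B))\<close>, the exponential moment
  \<open>exp (1 / (4 * B))\<close>.\<close>

lemma prob_mass_large:
  assumes R: "R \<subseteq> {..<N}"
  shows "measure_pmf.prob (mixed R H) {z. 2 * (\<Sum>r\<in>R. fst (z r)) > 1 - 2 * B} \<le> exp (1 - 1 / (4 * B))"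
proof -
  have fin: "finite R" using R finite_subset by blast
  let ?E = "{z. 2 * (\<Sum>r\<in>R. fst (z r)) > 1 - 2 * B}"
  have "measure_pmf.prob (mixed R H) ?E = measure_pmf.expectation (mixed R H) (indicator ?E)"
    by simp
  also have "\<dots> \<le> measure_pmf.expectation (mixed R H)
      (\<lambda>z. exp (1 - 1 / (2 * B)) * exp ((\<Sum>r\<in>R. fst (z r)) / B))"
  proof (rule integral_mono)
    fix z :: "nat \<Rightarrow> real \<times> real"
    show "indicator ?E z \<le> exp (1 - 1 / (2 * B)) * exp ((\<Sum>r\<in>R. fst (z r)) / B)"
    proof (cases "z \<in> ?E")
      case True
      hence "0 \<le> (2 * (\<Sum>r\<in>R. fst (z r)) - (1 - 2 * B)) / (2 * B)" using B_pos by simp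
      also have "\<dots> = 1 - 1 / (2 * B) + (\<Sum>r\<in>R. fst (z r)) / B"
        using B_pos by (simp add: field_simps)
      finally have "1 \<le> exp (1 - 1 / (2 * B) + (\<Sum>r\<in>R. fst (z r)) / B)" by simp
      thus ?thesis using True by (simp add: exp_add)
    qed simp
  qed (auto intro!: integrable_measure_pmf_finite finite_set_mixed fin)
  also have "\<dots> \<le> exp (1 - 1 / (2 * B)) * exp (1 / (4 * B))"
    using expectation_exp_mass[OF R] by simp
  also have "\<dots> = exp (1 - 1 / (4 * B))"
    using B_pos by (simp add: exp_add[symmetric] field_simps)
  finally show ?thesis .
qed

lemma expectation_mixed_split:
  fixes f :: "(nat \<Rightarrow> real \<times> real) \<Rightarrow> real"
  assumes "r < N"
  shows "measure_pmf.expectation (mixed {..<N} H) f =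
    measure_pmf.expectation (mixed ({..<N} - {r}) H)
      (\<lambda>z. measure_pmf.expectation (if r \<in> H then D1 else D0) (\<lambda>v. f (z(r := v))))"
proof -
  let ?R = "{..<N} - {r}"
  let ?D = "if r \<in> H then D1 else D0"
  have "mixed {..<N} H = mixed (insert r ?R) H" using assms by (simp add: insert_absorb)
  also have "\<dots> = mixed ?R H \<bind> (\<lambda>z. map_pmf (\<lambda>v. z(r := v)) ?D)"
    unfolding mixed_def
    by (subst Pi_pmf_insert') (auto simp: map_pmf_def bind_assoc_pmf bind_return_pmf intro: bind_commute_pmf)
  finally have eq: "mixed {..<N} H = mixed ?R H \<bind> (\<lambda>z. map_pmf (\<lambda>v. z(r := v)) ?D)" .
  show ?thesis unfolding eq
    by (subst pmf_expectation_bind[of "set_pmf (mixed ?R H)"])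
       (auto simp: finite_set_mixed finite_D integral_measure_pmf[of "set_pmf (mixed ?R H)"])
qed

text \<open>Condition on the other sites, whose law is the same on both sides. If they leave room
  for site \<open>r\<close>, the replacement bound applies; otherwise the difference is at most 1,
  on an event controlled by \<open>prob_mass_large\<close>.\<close>

lemma hybrid_step:
  assumes r: "r < N" "r \<notin> H"
    and sc: "sample_complexity n A \<le> enat k" and \<rho>: "\<rho> \<ge> 1"
  shows "\<bar>measure_pmf.expectation (mixed {..<N} (insert r H)) (site_accept N A)
      - measure_pmf.expectation (mixed {..<N} H) (site_accept N A)\<bar>
     \<le> 2 / \<rho> ^ Suc L * (1 + 6 * (\<rho> * B)) ^ k + exp (1 - 1 / (4 * B))"
proof -
  let ?R = "{..<N} - {r}" and ?\<eta> = "2 / \<rho> ^ Suc L * (1 + 6 * (\<rho> * B)) ^ k"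
  let ?E = "{z :: nat \<Rightarrow> real \<times> real. 2 * (\<Sum>r\<in>?R. fst (z r)) > 1 - 2 * B}"
  define e where "e D z = measure_pmf.expectation D (\<lambda>v. site_accept N A (z(r := v)))"
    for D :: "(real \<times> real) pmf" and z
  have fin: "finite (set_pmf (mixed ?R H))" by (rule finite_set_mixed) simp
  have same: "mixed ?R (insert r H) = mixed ?R H"
    unfolding mixed_def by (intro Pi_pmf_cong) auto
  have "measure_pmf.expectation (mixed {..<N} (insert r H)) (site_accept N A)
      - measure_pmf.expectation (mixed {..<N} H) (site_accept N A)
    = measure_pmf.expectation (mixed ?R H) (\<lambda>z. e D1 z - e D0 z)"
    unfolding expectation_mixed_split[OF r(1)] same e_def[symmetric] using r(2) fin
    by (simp add: integrable_measure_pmf_finite)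
  also have "\<bar>\<dots>\<bar> \<le> measure_pmf.expectation (mixed ?R H) (\<lambda>z. \<bar>e D1 z - e D0 z\<bar>)"
    by (rule integral_abs_bound)
  also have "\<dots> \<le> measure_pmf.expectation (mixed ?R H) (\<lambda>z. ?\<eta> + indicator ?E z)"
  proof (rule integral_mono_AE)
    show "AE z in measure_pmf (mixed ?R H). \<bar>e D1 z - e D0 z\<bar> \<le> ?\<eta> + indicator ?E z"
      unfolding AE_measure_pmf_iff
    proof
      fix z assume z: "z \<in> set_pmf (mixed ?R H)"
      have \<eta>: "?\<eta> \<ge> 0" using \<rho> B_pos by simp
      show "\<bar>e D1 z - e D0 z\<bar> \<le> ?\<eta> + indicator ?E z"
      proof (cases "z \<in> ?E")
        case True
        have e01: "0 \<le> e D z" "e D z \<le> 1" for D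
          unfolding e_def by (auto intro!: integral_nonneg measure_pmf.integral_le_const
              measure_pmf.integrable_const_bound[where B = 1] simp: site_accept_bounds)
        from e01[of D0] e01[of D1] have "\<bar>e D1 z - e D0 z\<bar> \<le> 1" by linarith
        thus ?thesis using True \<eta> by simp
      next
        case False
        hence "\<bar>e D1 z - e D0 z\<bar> \<le> ?\<eta>"
          unfolding e_def using mixed_support(1)[OF _ z] sc \<rho> r
          by (intro site_replacement_bound) auto
        thus ?thesis using False by simp
      qed
    qed
  qed (auto intro!: integrable_measure_pmf_finite fin)
  also have "\<dots> = ?\<eta> + measure_pmf.prob (mixed ?R H) ?E"
    using fin by (subst Bochner_Integration.integral_add) (auto intro!: integrable_measure_pmf_finite)
  also have "\<dots> \<le> ?\<eta> + exp (1 - 1 / (4 * B))"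
    by (intro add_left_mono prob_mass_large) auto
  finally show ?thesis .
qed

text \<open>Telescoping over the hybrids in which the first \<open>h\<close> sites follow
  \<open>D1\<close>.\<close>

lemma hybrid_bound:
  assumes sc: "sample_complexity n A \<le> enat k" and \<rho>: "\<rho> \<ge> 1"
  shows "\<bar>measure_pmf.expectation (mixed {..<N} UNIV) (site_accept N A)
      - measure_pmf.expectation (mixed {..<N} {}) (site_accept N A)\<bar>
     \<le> N * (2 / \<rho> ^ Suc L * (1 + 6 * (\<rho> * B)) ^ k + exp (1 - 1 / (4 * B)))"
proof -
  let ?\<eta> = "2 / \<rho> ^ Suc L * (1 + 6 * (\<rho> * B)) ^ k + exp (1 - 1 / (4 * B))"
  let ?e = "\<lambda>H. measure_pmf.expectation (mixed {..<N} H) (site_accept N A)"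
  have "\<bar>?e {..<h} - ?e {}\<bar> \<le> h * ?\<eta>" if "h \<le> N" for h
    using that
  proof (induction h)
    case (Suc h)
    have "\<bar>?e (insert h {..<h}) - ?e {..<h}\<bar> \<le> ?\<eta>"
      using Suc.prems by (intro hybrid_step sc \<rho>) auto
    moreover have "\<bar>?e {..<h} - ?e {}\<bar> \<le> h * ?\<eta>" using Suc by simp
    ultimately have "\<bar>?e (insert h {..<h}) - ?e {}\<bar> \<le> ?\<eta> + h * ?\<eta>" by linarith
    thus ?case by (simp only: lessThan_Suc of_nat_Suc distrib_right mult_1)
  qed simp
  moreover have "mixed {..<N} UNIV = mixed {..<N} {..<N}"
    unfolding mixed_def by (intro Pi_pmf_cong) auto
  ultimately show ?thesis by simp
qed

end

section \<open>The hard instances\<close>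

definition site_law :: "nat pmf \<Rightarrow> (nat \<Rightarrow> real) \<Rightarrow> (nat \<Rightarrow> real) \<Rightarrow> (real \<times> real) pmf" where
  "site_law \<pi> x w = map_pmf (\<lambda>(j, b). (x j, if b then w j else - w j)) (pair_pmf \<pi> (bernoulli_pmf (1/2)))"

lemma expectation_site_law:
  fixes f :: "real \<times> real \<Rightarrow> real"
  assumes "set_pmf \<pi> \<subseteq> {..<M}"
  shows "measure_pmf.expectation (site_law \<pi> x w) f
     = (\<Sum>j<M. pmf \<pi> j * ((f (x j, w j) + f (x j, - w j)) / 2))"
proof -
  have "measure_pmf.expectation (site_law \<pi> x w) f =
      measure_pmf.expectation (pair_pmf \<pi> (bernoulli_pmf (1/2))) (\<lambda>(j, b). f (x j, if b then w j else - w j))"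
    by (simp add: site_law_def case_prod_unfold)
  also have "\<dots> = (\<Sum>(j, b)\<in>{..<M} \<times> UNIV. pmf \<pi> j * (1 / 2) * f (x j, if b then w j else - w j))"
    using assms by (subst integral_measure_pmf[of "{..<M} \<times> UNIV"])
      (auto simp: pmf_pair case_prod_unfold intro!: sum.cong)
  also have "\<dots> = (\<Sum>j<M. \<Sum>b\<in>UNIV. pmf \<pi> j * (1 / 2) * f (x j, if b then w j else - w j))"
    by (simp add: sum.cartesian_product)
  also have "\<dots> = (\<Sum>j<M. pmf \<pi> j * ((f (x j, w j) + f (x j, - w j)) / 2))"
    by (intro sum.cong refl) (simp add: UNIV_bool algebra_simps)
  finally show ?thesis .
qed

lemma set_site_law: "set_pmf (site_law \<pi> x w) \<subseteq> (\<Union>j\<in>set_pmf \<pi>. {(x j, w j), (x j, - w j)})"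
  by (auto simp: site_law_def)

lemma tv_dist_site_pmf:
  assumes "site_valid N z" "2 * N + 1 \<le> n"
  shows "tv_dist n (site_pmf N 1 z) (site_pmf N (-1) z) = 2 * (\<Sum>r<N. \<bar>snd (z r)\<bar>)"
proof -
  have "(\<Sum>i=1..n. \<bar>site_mass N 1 z i - site_mass N (-1) z i\<bar>)
     = (\<Sum>r<N. \<bar>site_mass N 1 z (2 * r + 1) - site_mass N (-1) z (2 * r + 1)\<bar>
         + \<bar>site_mass N 1 z (2 * r + 2) - site_mass N (-1) z (2 * r + 2)\<bar>)
       + \<bar>site_mass N 1 z (2 * N + 1) - site_mass N (-1) z (2 * N + 1)\<bar>"
    using assms(2) by (rule sum_over_sites) (simp add: site_mass_def)
  also have "\<dots> = (\<Sum>r<N. 4 * \<bar>snd (z r)\<bar>)"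
    unfolding site_mass_simps(3)
    by (simp, intro sum.cong refl)
       (use site_mass_simps(1,2)[of _ N _ z] in \<open>simp add: eval_nat_numeral\<close>)
  finally show ?thesis
    unfolding tv_dist_def using assms(1) by (simp add: pmf_site_pmf sum_distrib_left)
qed

text \<open>A site with \<open>w \<noteq> 0\<close> contributes \<open>8 * t * x / (x - t)\<close>,
  which is at most \<open>10 * t\<close> once \<open>x\<close> is at least \<open>5 * t\<close>; a
  site with \<open>w = 0\<close> contributes nothing. So only the number of sites with
  \<open>w \<noteq> 0\<close> counts.\<close>

lemma chi2_dist_site_pmf_le:
  assumes "site_valid N z" "2 * N + 1 \<le> n" and t: "t > 0"
    and z: "\<And>r. r < N \<Longrightarrow> fst (z r) > 0"
    and w: "\<And>r. r < N \<Longrightarrow> snd (z r) \<noteq> 0 \<Longrightarrow> (snd (z r))\<^sup>2 = t * fst (z r) \<and> 7 * t \<le> fst (z r)"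
  shows "chi2_dist n (site_pmf N 1 z) (site_pmf N (-1) z)
     \<le> ennreal (10 * t * (\<Sum>r<N. of_bool (snd (z r) \<noteq> 0)))"
proof -
  let ?f = "\<lambda>i. ennreal ((site_mass N 1 z i - site_mass N (-1) z i)\<^sup>2) / ennreal (site_mass N (-1) z i)"
  have "(\<Sum>i=1..n. ?f i) = (\<Sum>r<N. ?f (2 * r + 1) + ?f (2 * r + 2)) + ?f (2 * N + 1)"
    using assms(2) by (rule sum_over_sites) (simp add: site_mass_def)
  also have "?f (2 * N + 1) = 0" unfolding site_mass_simps(3) by simp
  also have "(\<Sum>r<N. ?f (2 * r + 1) + ?f (2 * r + 2)) + 0 \<le> (\<Sum>r<N. ennreal (10 * t * of_bool (snd (z r) \<noteq> 0)))"
    unfolding add_0_right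
  proof (rule sum_mono)
    fix r assume "r \<in> {..<N}"
    hence r: "r < N" by simp
    define x where "x = fst (z r)"
    define v where "v = snd (z r)"
    have x: "x > 0" using z[OF r] by (simp add: x_def)
    have f: "?f (2 * r + 1) = ennreal ((2 * v)\<^sup>2) / ennreal (x - v)"
            "?f (2 * r + 2) = ennreal ((2 * v)\<^sup>2) / ennreal (x + v)"
      unfolding site_mass_simps(1,2)[OF r] x_def v_def by (simp_all add: power2_eq_square)
    show "?f (2 * r + 1) + ?f (2 * r + 2) \<le> ennreal (10 * t * of_bool (snd (z r) \<noteq> 0))"
    proof (cases "v = 0")
      case True
      thus ?thesis unfolding f by simp
    next
      case False
      hence v: "v\<^sup>2 = t * x" "7 * t \<le> x" using w[OF r] by (auto simp: x_def v_def)
      have "t * x < x * x" using v t x by (intro mult_strict_right_mono) auto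
      hence "v\<^sup>2 < x\<^sup>2" using v by (simp add: power2_eq_square)
      hence "\<bar>v\<bar> < x" using x by (metis abs_of_pos power2_less_imp_less power2_abs abs_ge_zero less_imp_le)
      hence pos: "x - v > 0" "x + v > 0" by linarith+
      have "?f (2 * r + 1) + ?f (2 * r + 2) = ennreal ((2 * v)\<^sup>2 / (x - v) + (2 * v)\<^sup>2 / (x + v))"
        unfolding f using pos by (simp add: divide_ennreal ennreal_plus[symmetric] del: ennreal_plus)
      also have "(2 * v)\<^sup>2 / (x - v) + (2 * v)\<^sup>2 / (x + v) = 8 * v\<^sup>2 * x / (x\<^sup>2 - v\<^sup>2)"
        using pos by (simp add: add_frac_eq power2_eq_square algebra_simps)
      also have "\<dots> \<le> 10 * t"
      proof -
        have "8 * (t * x) * x \<le> 10 * t * (x * x - t * x)"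
        proof -
          have "0 \<le> t * x * (2 * x - 10 * t)" using t x v(2) by (intro mult_nonneg_nonneg) auto
          thus ?thesis by (simp add: algebra_simps)
        qed
        moreover have "x * x - t * x > 0" using \<open>t * x < x * x\<close> by simp
        ultimately show ?thesis unfolding v(1) unfolding power2_eq_square by (simp add: pos_divide_le_eq)
      qed
      finally show ?thesis using False by (simp add: v_def ennreal_leI)
    qed
  qed
  also have "\<dots> = ennreal (\<Sum>r<N. 10 * t * of_bool (snd (z r) \<noteq> 0))"
    using t by (intro sum_ennreal) auto
  also have "(\<Sum>r<N. 10 * t * of_bool (snd (z r) \<noteq> 0)) = 10 * t * (\<Sum>r<N. of_bool (snd (z r) \<noteq> 0))"
    by (simp add: sum_distrib_left)
  finally show ?thesis
    unfolding chi2_dist_def using assms(1) by (simp add: pmf_site_pmf)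
qed

lemma (in matching_sites) expectation_mixed_component:
  fixes f :: "real \<times> real \<Rightarrow> real"
  assumes "r < N"
  shows "measure_pmf.expectation (mixed {..<N} H) (\<lambda>z. f (z r)) = measure_pmf.expectation (if r \<in> H then D1 else D0) f"
proof -
  have "measure_pmf.expectation (mixed {..<N} H) (\<lambda>z. f (z r))
     = measure_pmf.expectation (map_pmf (\<lambda>z. z r) (mixed {..<N} H)) f" by simp
  thus ?thesis using assms by (simp add: mixed_def Pi_pmf_component)
qed

section \<open>Close and far instances built from the matched moments\<close>

locale hard_instance =
  fixes \<pi> :: "nat pmf" and y :: "nat \<Rightarrow> real" and a :: real and K N n :: nat
  assumes \<pi>: "set_pmf \<pi> \<subseteq> {..<4*K}" and a0: "a > 0" and a_ge: "1 / a \<le> 80000000 * (real K)\<^sup>2"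
    and y0: "y 0 = a" and y_ge7: "\<And>j. j \<in> {1..<4*K} \<Longrightarrow> 7 * a \<le> y j"
    and y_ge: "\<And>j. j < 4*K \<Longrightarrow> a \<le> y j" and y_le: "\<And>j. j < 4*K \<Longrightarrow> y j \<le> 2"
    and alternating: "\<And>i. 1 \<le> i \<Longrightarrow> i \<le> Suc K \<Longrightarrow> (\<Sum>j<4*K. (-1) ^ j * pmf \<pi> j * y j ^ i) = 0"
    and \<pi>0: "pmf \<pi> 0 \<ge> 1 / 2" and \<pi>_rest: "(\<Sum>j\<in>{1..<4*K}. pmf \<pi> j) \<le> 7 / 10000000"
    and mean: "(\<Sum>j<4*K. pmf \<pi> j * y j) \<le> 10 * a"
    and K: "K \<ge> 1" and N: "N > 0" and Nn: "2 * N + 1 \<le> n"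
begin

text \<open>
  The scale \<open>\<tau>\<close> makes the expected total mass of all sites at most \<open>1/4\<close>; by the choice
  \<open>t = \<tau> a\<close> the lightest sites have \<open>w = x\<close>.
\<close>

definition "\<tau> = 1 / (80 * N * a)"
definition "t = 1 / (80 * real N)"
definition "x j = \<tau> * y j"
definition "w P j = (if P j then \<tau> * sqrt (a * y j) else 0)"
text \<open>The predicate \<open>P\<close> selects the nodes with \<open>w \<noteq> 0\<close>. With
  \<open>odd\<close> these are few and heavy, the close case; with \<open>even\<close> they include
  the light and likely node 0, the far case.\<close>

definition "D P = site_law \<pi> x (w P)"
text \<open>An upper bound for \<open>x j\<close>, obtained from \<open>y j \<le> 2\<close> and the
  bound on \<open>1 / a\<close>.\<close>

definition "B = 2000000 * (real K)\<^sup>2 / N"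

lemma \<tau>: "\<tau> > 0" "\<tau> * a = t" and t0: "t > 0"
  using a0 N by (auto simp: \<tau>_def t_def)

lemma B0: "B > 0" using K N by (simp add: B_def)

lemma x_bounds:
  assumes "j < 4*K"
  shows "x j > 0" "x j \<le> B"
proof -
  show "x j > 0" using y_ge[OF assms] a0 \<tau> by (simp add: x_def)
  have "x j \<le> \<tau> * 2" unfolding x_def using y_le[OF assms] \<tau> by (intro mult_left_mono) auto
  also have "\<dots> = 1 / a * (1 / (40 * N))" by (simp add: \<tau>_def)
  also have "\<dots> \<le> 80000000 * (real K)\<^sup>2 * (1 / (40 * N))" using a_ge by (intro mult_right_mono) auto
  also have "\<dots> = B" by (simp add: B_def)
  finally show "x j \<le> B" .
qed

lemma w_bounds:
  assumes "j < 4*K"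
  shows "0 \<le> w P j" "w P j \<le> x j"
proof -
  have y: "a \<le> y j" "y j > 0" using y_ge[OF assms] a0 by auto
  show "0 \<le> w P j" using y a0 \<tau> by (simp add: w_def)
  have "sqrt (a * y j) \<le> sqrt (y j * y j)"
    using y by (intro real_sqrt_le_mono mult_right_mono) auto
  hence "sqrt (a * y j) \<le> y j" using y by simp
  thus "w P j \<le> x j" using \<tau> y by (simp add: w_def x_def)
qed

lemma w_sq:
  assumes "j < 4*K" "P j"
  shows "(w P j)\<^sup>2 = t * x j"
  using assms y_ge[OF assms(1)] a0 by (simp add: w_def x_def \<tau>(2)[symmetric] power_mult_distrib power2_eq_square[of \<tau>])

lemma set_D:
  assumes "v \<in> set_pmf (D P)"
  obtains j where "j < 4*K" "fst v = x j" "\<bar>snd v\<bar> = w P j"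
proof -
  obtain j where j: "j \<in> set_pmf \<pi>" "v = (x j, w P j) \<or> v = (x j, - w P j)"
    using assms set_site_law[of \<pi> x "w P"] unfolding D_def by blast
  have "j < 4*K" using j(1) \<pi> by auto
  thus ?thesis using that[of j] j(2) w_bounds[of j P] by auto
qed

text \<open>For odd \<beta> both sides vanish by the symmetry of the sign; for \<beta> = 0 only
  \<open>x\<close> enters. For \<beta> = 2 c > 0 the identity \<open>w_sq\<close> turns the moment
  into one of \<open>y\<close> of order \<alpha> + c over the selected nodes, and this order lies
  between 1 and \<open>K + 1\<close>.\<close>

lemma D_moments:
  assumes "\<alpha> + \<beta> \<le> Suc K"
  shows "measure_pmf.expectation (D odd) (\<lambda>v. fst v ^ \<alpha> * snd v ^ \<beta>)
     = measure_pmf.expectation (D even) (\<lambda>v. fst v ^ \<alpha> * snd v ^ \<beta>)"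
proof (cases "even \<beta> \<and> \<beta> > 0")
  case True
  then obtain c where c: "\<beta> = 2 * c" "c \<ge> 1" by (auto elim!: evenE)
  have E: "measure_pmf.expectation (D P) (\<lambda>v. fst v ^ \<alpha> * snd v ^ \<beta>)
     = \<tau> ^ \<alpha> * t ^ c * \<tau> ^ c * (\<Sum>j<4*K. of_bool (P j) * pmf \<pi> j * y j ^ (\<alpha> + c))" for P
  proof -
    have eq: "pmf \<pi> j * ((x j ^ \<alpha> * w P j ^ \<beta> + x j ^ \<alpha> * (- w P j) ^ \<beta>) / 2)
       = \<tau> ^ \<alpha> * t ^ c * \<tau> ^ c * (of_bool (P j) * pmf \<pi> j * y j ^ (\<alpha> + c))" if "j < 4*K" for j
    proof (cases "P j")
      case True
      have "w P j ^ \<beta> = (t * x j) ^ c" "(- w P j) ^ \<beta> = (t * x j) ^ c"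
        using w_sq[OF that, of P] True by (simp_all add: c(1) power_mult)
      thus ?thesis using True by (simp add: x_def power_mult_distrib power_add)
    next
      case False
      thus ?thesis using c by (simp add: w_def)
    qed
    show ?thesis unfolding D_def expectation_site_law[OF \<pi>] sum_distrib_left
      by (intro sum.cong refl) (simp only: lessThan_iff fst_conv snd_conv eq)
  qed
  have "(\<Sum>j<4*K. of_bool (even j) * pmf \<pi> j * y j ^ (\<alpha> + c)) - (\<Sum>j<4*K. of_bool (odd j) * pmf \<pi> j * y j ^ (\<alpha> + c))
      = (\<Sum>j<4*K. (-1) ^ j * pmf \<pi> j * y j ^ (\<alpha> + c))"
    unfolding sum_subtractf[symmetric] by (intro sum.cong refl) auto
  also have "\<dots> = 0" using assms c by (intro alternating) auto
  finally show ?thesis unfolding E by simp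
next
  case False
  show ?thesis
  proof (cases "\<beta> = 0")
    case True
    thus ?thesis unfolding D_def expectation_site_law[OF \<pi>] by simp
  next
    case nz: False
    hence "odd \<beta>" using False by auto
    thus ?thesis unfolding D_def expectation_site_law[OF \<pi>] by simp
  qed
qed

lemma D_mean: "measure_pmf.expectation (D P) fst \<le> 1 / (8 * N)"
proof -
  have "measure_pmf.expectation (D P) fst = \<tau> * (\<Sum>j<4*K. pmf \<pi> j * y j)"
    unfolding D_def expectation_site_law[OF \<pi>] by (simp add: x_def sum_distrib_left mult_ac)
  also have "\<dots> \<le> \<tau> * (10 * a)" using mean \<tau> by (intro mult_left_mono) auto
  also have "\<dots> = 1 / (8 * N)" using a0 by (simp add: \<tau>_def)
  finally show ?thesis .
qed

text \<open>Hence \<open>mixed {..<N} {}\<close> is the close instance and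
  \<open>mixed {..<N} UNIV\<close> the far one.\<close>

sublocale matching_sites "D odd" "D even" B "Suc K" n N
proof
  have "finite (set_pmf (site_law \<pi> x (w P)))" for P
    using \<pi> finite_subset[OF set_site_law] by (meson finite.emptyI finite.insertI finite_UN_I finite_lessThan finite_subset)
  thus "finite (set_pmf (D odd))" "finite (set_pmf (D even))" by (auto simp: D_def)
  have "\<bar>snd v\<bar> \<le> fst v \<and> fst v \<le> B" if v: "v \<in> set_pmf (D P)" for v P
    using set_D[OF v] w_bounds x_bounds by metis
  thus "\<bar>snd v\<bar> \<le> fst v \<and> fst v \<le> B" if "v \<in> set_pmf (D odd) \<union> set_pmf (D even)" for v
    using that by blast
qed (use D_moments D_mean B0 N Nn in auto)

lemma mixed_component:
  assumes "z \<in> set_pmf (mixed {..<N} H)" "r < N"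
  shows "z r \<in> set_pmf (D (if r \<in> H then even else odd))"
  using assms unfolding mixed_def by (auto simp: set_Pi_pmf PiE_dflt_def split: if_splits)

text \<open>An instance is close unless its total mass is too large or too many sites have
  \<open>w \<noteq> 0\<close>. The tail bound handles the first event; Markov's inequality, built
  into the pointwise minorant, handles the second.\<close>

lemma accept_close:
  assumes dist: "distinguishes n (1 / 320) A"
  shows "measure_pmf.expectation (mixed {..<N} {}) (site_accept N A)
     \<ge> 2 / 3 * (19 / 20 - exp (1 - 1 / (4 * B)))"
proof -
  let ?M = "mixed {..<N} {}"
  let ?E = "{z :: nat \<Rightarrow> real \<times> real. 2 * (\<Sum>r<N. fst (z r)) > 1 - 2 * B}"
  let ?s = "\<lambda>z :: nat \<Rightarrow> real \<times> real. \<Sum>r<N. of_bool (snd (z r) \<noteq> 0) :: real"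
  have fin: "finite (set_pmf ?M)" by (rule finite_set_mixed) simp
  \<comment> \<open>The bound \<open>10 * t * ?s z\<close> must not exceed
    \<open>(1 / 320) ^ 2 / 4 = 1 / 409600\<close>, whence the constant 4096000.\<close>
  have "measure_pmf.expectation ?M (\<lambda>z. 2 / 3 * (1 - indicator ?E z - 4096000 * t * ?s z))
      \<le> measure_pmf.expectation ?M (site_accept N A)"
  proof (rule integral_mono_AE)
    show "AE z in measure_pmf ?M. 2 / 3 * (1 - indicator ?E z - 4096000 * t * ?s z) \<le> site_accept N A z"
      unfolding AE_measure_pmf_iff
    proof
      fix z assume z: "z \<in> set_pmf ?M"
      have s0: "?s z \<ge> 0" by (intro sum_nonneg) auto
      hence ts0: "t * ?s z \<ge> 0" using t0 by simp
      show "2 / 3 * (1 - indicator ?E z - 4096000 * t * ?s z) \<le> site_accept N A z"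
      proof (cases "z \<in> ?E \<or> 4096000 * t * ?s z > 1")
        case True
        hence "2 / 3 * (1 - indicator ?E z - 4096000 * t * ?s z) \<le> 0"
          using ts0 by (auto simp: indicator_def)
        thus ?thesis using site_accept_bounds(1)[of N A z] by linarith
      next
        case False
        hence mass: "2 * (\<Sum>r<N. fst (z r)) \<le> 1" and chi: "4096000 * t * ?s z \<le> 1" using B0 by auto
        have valid: "site_valid N z"
          unfolding site_valid_def using mass mixed_support(1)[OF _ z] by auto
        have zr: "fst (z r) > 0"
            "snd (z r) \<noteq> 0 \<Longrightarrow> (snd (z r))\<^sup>2 = t * fst (z r) \<and> 7 * t \<le> fst (z r)" if r: "r < N" for r
        proof -
          from mixed_component[OF z r] have "z r \<in> set_pmf (D odd)" by simp
          then obtain j where j: "j < 4*K" "fst (z r) = x j" "\<bar>snd (z r)\<bar> = w odd j" by (rule set_D)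
          show "fst (z r) > 0" using j x_bounds by simp
          show "(snd (z r))\<^sup>2 = t * fst (z r) \<and> 7 * t \<le> fst (z r)" if "snd (z r) \<noteq> 0"
          proof
            have odd: "odd j" using that j by (auto simp: w_def split: if_splits)
            show "(snd (z r))\<^sup>2 = t * fst (z r)"
              using w_sq[of j odd] j odd by (metis power2_abs)
            have "7 * a \<le> y j" using j(1) odd by (intro y_ge7) (auto elim: oddE)
            hence "\<tau> * (7 * a) \<le> \<tau> * y j" using \<tau> by (intro mult_left_mono) auto
            thus "7 * t \<le> fst (z r)" using j by (simp add: x_def \<tau>(2)[symmetric] mult_ac)
          qed
        qed
        have "chi2_dist n (site_pmf N 1 z) (site_pmf N (-1) z) \<le> ennreal (10 * t * ?s z)"
          using chi2_dist_site_pmf_le[OF valid Nn t0] zr by blast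
        also have "\<dots> \<le> ennreal ((1 / 320)\<^sup>2 / 4)"
          using chi by (intro ennreal_leI) (simp add: power2_eq_square)
        finally have "pmf (run (site_pmf N 1 z) (site_pmf N (-1) z) A) True \<ge> 2 / 3"
          using dist site_pmf_in_dists[OF valid _ Nn] unfolding distinguishes_def by simp
        hence "site_accept N A z \<ge> 2 / 3" using mass by (simp add: site_accept_def)
        moreover have "2 / 3 * (1 - indicator ?E z - 4096000 * t * ?s z) \<le> 2 / 3"
          using ts0 by (auto simp: indicator_def)
        ultimately show ?thesis by linarith
      qed
    qed
  qed (auto intro!: integrable_measure_pmf_finite fin)
  moreover have "measure_pmf.expectation ?M (\<lambda>z. 2 / 3 * (1 - indicator ?E z - 4096000 * t * ?s z))
     = 2 / 3 * (1 - measure_pmf.prob ?M ?E - 4096000 * t * measure_pmf.expectation ?M ?s)"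
    using fin by (simp add: integrable_measure_pmf_finite)
  moreover have "measure_pmf.prob ?M ?E \<le> exp (1 - 1 / (4 * B))"
    by (rule prob_mass_large) simp
  \<comment> \<open>Node 0 is even, so each site has \<open>w \<noteq> 0\<close> with probability at
    most \<open>7 / 10000000\<close>; with \<open>t = 1 / (80 * N)\<close> the product is below
    0.036.\<close>
  moreover have "4096000 * t * measure_pmf.expectation ?M ?s \<le> 1 / 20"
  proof -
    have "measure_pmf.expectation ?M ?s = (\<Sum>r<N. measure_pmf.expectation ?M (\<lambda>z. of_bool (snd (z r) \<noteq> 0)))"
      using fin by (intro Bochner_Integration.integral_sum integrable_measure_pmf_finite)
    also have "\<dots> = (\<Sum>r<N. measure_pmf.expectation (D odd) (\<lambda>v. of_bool (snd v \<noteq> 0)))"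
      using expectation_mixed_component[of _ "{}" "\<lambda>v. of_bool (snd v \<noteq> 0)"]
      by (intro sum.cong refl) simp
    also have "measure_pmf.expectation (D odd) (\<lambda>v. of_bool (snd v \<noteq> 0)) = (\<Sum>j<4*K. pmf \<pi> j * of_bool (w odd j \<noteq> 0))"
      unfolding D_def expectation_site_law[OF \<pi>] by simp
    also have "\<dots> = (\<Sum>j\<in>{1..<4*K}. pmf \<pi> j * of_bool (w odd j \<noteq> 0))"
      by (intro sum.mono_neutral_right) (auto simp: w_def Suc_le_eq)
    also have "(\<Sum>r<N. \<dots>) \<le> (\<Sum>r<N. 7 / 10000000)"
      by (intro sum_mono order_trans[OF sum_mono \<pi>_rest]) auto
    finally have "measure_pmf.expectation ?M ?s \<le> N * (7 / 10000000)" by simp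
    hence "4096000 * t * measure_pmf.expectation ?M ?s \<le> 4096000 * t * (N * (7 / 10000000))"
      using t0 by (intro mult_left_mono) auto
    also have "\<dots> \<le> 1 / 20" using N by (simp add: t_def)
    finally show ?thesis .
  qed
  ultimately show ?thesis by argo
qed

text \<open>A Chernoff bound for the lower tail of the sum of the moduli of \<open>w\<close>. Node 0
  has probability at least 1/2 and \<open>w = t\<close>, so one site contributes at most 3/4 \<le>
  exp (-1/4). The level \<open>N * t / 8 = 1 / 640\<close> corresponds to total variation distance
  1/320, which fixes the choice of \<epsilon>.\<close>

lemma accept_far:
  assumes dist: "distinguishes n (1 / 320) A"
  shows "measure_pmf.expectation (mixed {..<N} UNIV) (site_accept N A) \<le> 1 / 3 + exp (- (real N / 8))"
proof -
  let ?M = "mixed {..<N} UNIV"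
  let ?h = "\<lambda>v :: real \<times> real. exp (- (\<bar>snd v\<bar> / t))"
  have fin: "finite (set_pmf ?M)" by (rule finite_set_mixed) simp
  have "measure_pmf.expectation ?M (site_accept N A)
     \<le> measure_pmf.expectation ?M (\<lambda>z. 1 / 3 + exp (real N / 8) * (\<Prod>r<N. ?h (z r)))"
  proof (rule integral_mono_AE)
    show "AE z in measure_pmf ?M. site_accept N A z \<le> 1 / 3 + exp (real N / 8) * (\<Prod>r<N. ?h (z r))"
      unfolding AE_measure_pmf_iff
    proof
      fix z assume z: "z \<in> set_pmf ?M"
      have prod: "exp (real N / 8) * (\<Prod>r<N. ?h (z r)) = exp (real N / 8 - (\<Sum>r<N. \<bar>snd (z r)\<bar>) / t)"
        by (simp add: exp_sum[symmetric] exp_add[symmetric] sum_negf sum_divide_distrib)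
      show "site_accept N A z \<le> 1 / 3 + exp (real N / 8) * (\<Prod>r<N. ?h (z r))"
      proof (cases "2 * (\<Sum>r<N. fst (z r)) \<le> 1 \<and> (\<Sum>r<N. \<bar>snd (z r)\<bar>) / t > real N / 8")
        case False
        have "site_accept N A z \<le> exp (real N / 8) * (\<Prod>r<N. ?h (z r))"
        proof (cases "2 * (\<Sum>r<N. fst (z r)) \<le> 1")
          case True
          hence "1 \<le> exp (real N / 8) * (\<Prod>r<N. ?h (z r))" unfolding prod using False by simp
          thus ?thesis using site_accept_bounds(2) order_trans by blast
        qed (simp add: site_accept_def prod_nonneg)
        thus ?thesis by simp
      next
        case True
        have valid: "site_valid N z"
          unfolding site_valid_def using True mixed_support(1)[OF _ z] by auto
        have "real N / 8 * t < (\<Sum>r<N. \<bar>snd (z r)\<bar>)" using True t0 by (simp add: pos_less_divide_eq)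
        hence "1 / 320 \<le> 2 * (\<Sum>r<N. \<bar>snd (z r)\<bar>)" using N by (simp add: t_def)
        hence "tv_dist n (site_pmf N 1 z) (site_pmf N (-1) z) \<ge> 1 / 320"
          by (simp add: tv_dist_site_pmf[OF valid Nn])
        hence "pmf (run (site_pmf N 1 z) (site_pmf N (-1) z) A) False \<ge> 2 / 3"
          using dist site_pmf_in_dists[OF valid _ Nn] unfolding distinguishes_def by simp
        hence "site_accept N A z \<le> 1 / 3" by (simp add: site_accept_def pmf_False_conv_True)
        thus ?thesis by (simp add: add_increasing2 prod_nonneg)
      qed
    qed
  qed (auto intro!: integrable_measure_pmf_finite fin)
  also have "\<dots> = 1 / 3 + exp (real N / 8) * measure_pmf.expectation ?M (\<lambda>z. \<Prod>r<N. ?h (z r))"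
    using fin by (subst Bochner_Integration.integral_add) (auto intro!: integrable_measure_pmf_finite)
  also have "measure_pmf.expectation ?M (\<lambda>z. \<Prod>r<N. ?h (z r)) = (\<Prod>r<N. measure_pmf.expectation (D even) ?h)"
    unfolding mixed_def
    by (subst expectation_prod_Pi_pmf) (auto intro: integrable_measure_pmf_finite finite_D)
  also have "\<dots> \<le> (\<Prod>r<N. exp (- 1 / 4))"
  proof (intro prod_mono conjI integral_nonneg)
    have ins: "{..<4*K} = insert 0 {1..<4*K}" using K by auto
    have one: "(\<Sum>j<4*K. pmf \<pi> j) = 1" using \<pi> by (intro sum_pmf_eq_1) auto
    have "measure_pmf.expectation (D even) ?h = (\<Sum>j<4*K. pmf \<pi> j * exp (- (\<bar>w even j\<bar> / t)))"
      unfolding D_def expectation_site_law[OF \<pi>] by simp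
    also have "\<dots> = pmf \<pi> 0 * exp (- (\<bar>w even 0\<bar> / t)) + (\<Sum>j\<in>{1..<4*K}. pmf \<pi> j * exp (- (\<bar>w even j\<bar> / t)))"
      unfolding ins by simp
    also have "\<dots> \<le> pmf \<pi> 0 * (1 / 2) + (\<Sum>j\<in>{1..<4*K}. pmf \<pi> j * 1)"
    proof (intro add_mono mult_left_mono sum_mono)
      have "w even 0 = t" using a0 \<tau>(2) by (simp add: w_def y0)
      moreover have "exp (-1 :: real) \<le> 1 / 2"
        using exp_ge_add_one_self[of 1] by (simp add: exp_minus field_simps)
      ultimately show "exp (- (\<bar>w even 0\<bar> / t)) \<le> 1 / 2" using t0 by simp
    qed (use t0 in auto)
    also have "\<dots> \<le> 1 + (- 1 / 4)" using one \<pi>0 unfolding ins by simp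
    also have "\<dots> \<le> exp (- 1 / 4)" by (rule exp_ge_add_one_self)
    finally show "measure_pmf.expectation (D even) ?h \<le> exp (- 1 / 4)" .
  qed auto
  also have "\<dots> = exp (- (real N / 4))" by (simp add: exp_of_nat_mult[symmetric])
  finally show ?thesis by (simp add: exp_add[symmetric] field_simps)
qed

text \<open>The tester accepts with probability at least 3/5 on the close instance and at most 23/60
  on the far one, and \<open>hybrid_bound\<close> has to cover the difference.\<close>

lemma distinguishing_gap:
  assumes dist: "distinguishes n (1 / 320) A" and sc: "sample_complexity n A \<le> enat k" and \<rho>: "\<rho> \<ge> 1"
    and small: "exp (1 - 1 / (4 * B)) \<le> 1 / 20" "exp (- (real N / 8)) \<le> 1 / 20"
  shows "N * (2 / \<rho> ^ (K + 2) * (1 + 6 * (\<rho> * B)) ^ k + exp (1 - 1 / (4 * B))) > 1 / 10"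
proof -
  have "2 / 3 * (19 / 20 - exp (1 - 1 / (4 * B))) - (1 / 3 + exp (- (real N / 8)))
     \<le> N * (2 / \<rho> ^ Suc (Suc K) * (1 + 6 * (\<rho> * B)) ^ k + exp (1 - 1 / (4 * B)))"
    using accept_close[OF dist] accept_far[OF dist] hybrid_bound[OF sc \<rho>] by linarith
  moreover have "2 / 3 * (19 / 20 - exp (1 - 1 / (4 * B))) - (1 / 3 + exp (- (real N / 8))) > 1 / 10"
    using small by argo
  ultimately show ?thesis unfolding add_2_eq_Suc' by (rule less_le_trans[rotated])
qed

end

section \<open>Choice of the parameters for large n\<close>

lemma distinguishes_imp_gap:
  assumes K: "K \<ge> 1" and N: "N > 0" "2 * N + 1 \<le> n"
    and dist: "distinguishes n (1 / 320) A" and sc: "sample_complexity n A \<le> enat k" and \<rho>: "\<rho> \<ge> 1"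
    and B: "B = 2000000 * (real K)\<^sup>2 / N"
    and small: "exp (1 - 1 / (4 * B)) \<le> 1 / 20" "exp (- (real N / 8)) \<le> 1 / 20"
  shows "N * (2 / \<rho> ^ (K + 2) * (1 + 6 * (\<rho> * B)) ^ k + exp (1 - 1 / (4 * B))) > 1 / 10"
proof -
  show ?thesis
  proof (rule ex_alternating_moment_pmf[OF K])
    fix \<pi> :: "nat pmf" and y :: "nat \<Rightarrow> real" and a :: real
    assume h: "set_pmf \<pi> \<subseteq> {..<4*K}" "a > 0" "1 / a \<le> 80000000 * (real K)\<^sup>2" "y 0 = a"
      "\<And>j. j \<in> {1..<4*K} \<Longrightarrow> 7 * a \<le> y j" "\<And>j. j < 4*K \<Longrightarrow> a \<le> y j" "\<And>j. j < 4*K \<Longrightarrow> y j \<le> 2"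
      "\<And>i. 1 \<le> i \<Longrightarrow> i \<le> Suc K \<Longrightarrow> (\<Sum>j<4*K. (-1) ^ j * pmf \<pi> j * y j ^ i) = 0"
      "pmf \<pi> 0 \<ge> 1 / 2" "(\<Sum>j\<in>{1..<4*K}. pmf \<pi> j) \<le> 7 / 10000000"
      "(\<Sum>j<4*K. pmf \<pi> j * y j) \<le> 10 * a"
    interpret hard_instance \<pi> y a K N n
      by unfold_locales (fact h K N)+
    show ?thesis
      using distinguishing_gap[OF dist sc \<rho>] small unfolding B B_def by blast
  qed
qed

text \<open>Take \<open>\<rho> = exp 4\<close> and \<open>K\<close> about ln n. For \<open>k\<close>
  this small the growth factor is at most \<open>exp K\<close>, while the power of \<rho> in the
  denominator exceeds \<open>exp (4 * K)\<close>; each exchange then costs at most 2 / n^2 plus the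
  tail term, so \<open>N\<close> exchanges cannot produce the gap 1/10.\<close>

lemma no_tester_with_few_samples:
  fixes n k :: nat
  assumes n: "n \<ge> 9"
    and dist: "distinguishes n (1 / 320) A" and sc: "sample_complexity n A \<le> enat k"
    and k: "real k \<le> real n / ln n / (72000000 * exp 4)"
    and s1: "n * exp (1 - n / (96000000 * (ln n)\<^sup>2)) \<le> 1 / 40"
    and s2: "exp (- (real n / 24)) \<le> 1 / 20" and s3: "2 / real n \<le> 1 / 40"
  shows False
proof -
  define N where "N = (n - 1) div 2"
  define K where "K = nat \<lceil>ln n\<rceil>"
  define B where "B = 2000000 * (real K)\<^sup>2 / N"
  have N: "N > 0" "2 * N + 1 \<le> n" "real n \<le> 3 * real N" using n by (auto simp: N_def)
  have ln1: "ln (real n) \<ge> 1"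
  proof -
    have "exp 1 \<le> real n" using exp_le n by linarith
    thus ?thesis using n by (subst ln_ge_iff) auto
  qed
  have K: "ln n \<le> K" "real K \<le> 2 * ln n" "K \<ge> 1"
  proof -
    show "ln n \<le> K" unfolding K_def using ln1 by linarith
    show "real K \<le> 2 * ln n" unfolding K_def using ln1 by linarith
    show "K \<ge> 1" using \<open>ln n \<le> K\<close> ln1 by linarith
  qed
  have B0: "B > 0" using K(3) N(1) by (simp add: B_def)
  have B_le: "B \<le> 6000000 * (real K)\<^sup>2 / n"
  proof -
    have "B = 6000000 * (real K)\<^sup>2 / (3 * N)" by (simp add: B_def)
    also have "\<dots> \<le> 6000000 * (real K)\<^sup>2 / n" using N n by (intro divide_left_mono) auto
    finally show ?thesis .
  qed
  \<comment> \<open>The constant 96000000 is 4 * 6000000 * 4, from the bound \<open>B_le\<close> and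
    \<open>K\<close> being at most twice ln n.\<close>
  have nexp: "n * exp (1 - 1 / (4 * B)) \<le> 1 / 40"
  proof -
    have "(real K)\<^sup>2 \<le> (2 * ln n)\<^sup>2" using K ln1 by (intro power_mono) auto
    hence "6000000 * (real K)\<^sup>2 / n \<le> 6000000 * (2 * ln n)\<^sup>2 / n"
      by (intro divide_right_mono mult_left_mono) auto
    hence "4 * B \<le> 96000000 * (ln n)\<^sup>2 / n" using B_le by (simp add: power_mult_distrib)
    hence "1 / (96000000 * (ln n)\<^sup>2 / n) \<le> 1 / (4 * B)" using B0 by (intro divide_left_mono) (use ln1 n in auto)
    hence "exp (1 - 1 / (4 * B)) \<le> exp (1 - n / (96000000 * (ln n)\<^sup>2))" by simp
    hence "n * exp (1 - 1 / (4 * B)) \<le> n * exp (1 - n / (96000000 * (ln n)\<^sup>2))" by (intro mult_left_mono) auto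
    thus ?thesis using s1 by linarith
  qed
  have exp1: "exp (1 - 1 / (4 * B)) \<le> 1 / 20"
  proof -
    have "1 * exp (1 - 1 / (4 * B)) \<le> n * exp (1 - 1 / (4 * B))" using n by (intro mult_right_mono) auto
    thus ?thesis using nexp by linarith
  qed
  have exp2: "exp (- (real N / 8)) \<le> 1 / 20"
  proof -
    have "exp (- (real N / 8)) \<le> exp (- (real n / 24))" using N by simp
    thus ?thesis using s2 by linarith
  qed
  have "N * (2 / exp 4 ^ (K + 2) * (1 + 6 * (exp 4 * B)) ^ k + exp (1 - 1 / (4 * B))) > 1 / 10"
    by (rule distinguishes_imp_gap[OF K(3) N(1,2) dist sc _ B_def exp1 exp2]) simp
  moreover have "2 / exp 4 ^ (K + 2) * (1 + 6 * (exp 4 * B)) ^ k \<le> 2 / (real n)\<^sup>2"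
  proof -
    \<comment> \<open>The constant in the bound on \<open>k\<close> is chosen so that the product
      becomes K^2 / (2 ln n), which is at most \<open>K\<close>.\<close>
    have "6 * (exp 4 * B) * k \<le> 6 * (exp 4 * (6000000 * (real K)\<^sup>2 / n)) * (real n / ln n / (72000000 * exp 4))"
      using B_le k B0 by (intro mult_mono) auto
    also have "\<dots> = (real K * (real K / ln n)) / 2"
      using n ln1 by (simp add: power2_eq_square)
    also have "\<dots> \<le> (real K * 2) / 2"
      using K ln1 by (intro divide_right_mono mult_left_mono) (auto simp: pos_divide_le_eq)
    finally have bk: "6 * (exp 4 * B) * k \<le> K" by simp
    have "(1 + 6 * (exp 4 * B)) ^ k \<le> exp (6 * (exp 4 * B)) ^ k"
      using B0 exp_ge_add_one_self by (intro power_mono) auto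
    also have "\<dots> = exp (6 * (exp 4 * B) * k)" by (simp add: exp_of_nat_mult[symmetric] mult_ac)
    also have "\<dots> \<le> exp K" using bk by simp
    finally have 1: "(1 + 6 * (exp 4 * B)) ^ k \<le> exp K" .
    have e4: "exp 4 ^ (K + 2) = (exp (real (K + 2) * 4) :: real)" by (rule exp_of_nat_mult[symmetric])
    have "2 / exp (real (K + 2) * 4) * (1 + 6 * (exp 4 * B)) ^ k \<le> 2 / exp (real (K + 2) * 4) * exp K"
      using 1 by (intro mult_left_mono) auto
    also have "\<dots> = 2 * exp (K - real (K + 2) * 4)"
      by (simp only: exp_diff) simp
    also have "\<dots> \<le> 2 * exp (- (2 * ln n))" using K(1) by simp
    also have "exp (- (2 * ln n)) = 1 / (real n)\<^sup>2"
      using n by (simp add: exp_minus exp_double field_simps)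
    finally show ?thesis unfolding e4 by simp
  qed
  ultimately have "1 / 10 < N * (2 / (real n)\<^sup>2 + exp (1 - 1 / (4 * B)))"
    using N by (smt (verit) mult_left_mono of_nat_0_le_iff)
  also have "\<dots> \<le> n * (2 / (real n)\<^sup>2 + exp (1 - 1 / (4 * B)))"
    using N by (intro mult_right_mono) auto
  also have "\<dots> = 2 / n + n * exp (1 - 1 / (4 * B))"
    using n by (simp add: power2_eq_square distrib_left)
  also have "\<dots> \<le> 1 / 40 + 1 / 40" using s3 nexp by linarith
  finally show False by simp
qed

theorem theorem6p3:
  "\<exists>\<epsilon> c' :: real. \<epsilon> > 0 \<and> c' > 0 \<and>
     (\<exists>n\<^sub>0 :: nat. \<forall>n\<ge>n\<^sub>0. \<forall>A :: tester.
        distinguishes n \<epsilon> A \<longrightarrow>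
        ereal_of_enat (sample_complexity n A) \<ge> ereal (c' * (real n / ln (real n))))"
proof -
  have "eventually (\<lambda>n::nat. n * exp (1 - n / (96000000 * (ln n)\<^sup>2)) \<le> 1 / 40) at_top"
       "eventually (\<lambda>n::nat. exp (- (real n / 24)) \<le> 1 / 20) at_top"
       "eventually (\<lambda>n::nat. 2 / real n \<le> 1 / 40) at_top"
    by real_asymp+
  hence "eventually (\<lambda>n::nat. 9 \<le> n \<and> n * exp (1 - n / (96000000 * (ln n)\<^sup>2)) \<le> 1 / 40
      \<and> exp (- (real n / 24)) \<le> 1 / 20 \<and> 2 / real n \<le> 1 / 40) at_top"
    by (intro eventually_conj eventually_ge_at_top)
  then obtain n\<^sub>0 :: nat where n0: "\<And>n::nat. n \<ge> n\<^sub>0 \<Longrightarrow> 9 \<le> n \<and> n * exp (1 - n / (96000000 * (ln n)\<^sup>2)) \<le> 1 / 40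
      \<and> exp (- (real n / 24)) \<le> 1 / 20 \<and> 2 / real n \<le> 1 / 40"
    by (auto simp: eventually_at_top_linorder)
  have "ereal_of_enat (sample_complexity n A) \<ge> ereal (1 / (72000000 * exp 4) * (real n / ln (real n)))"
    if n: "n \<ge> n\<^sub>0" and dist: "distinguishes n (1 / 320) A" for n A
  proof (cases "sample_complexity n A")
    case (enat k)
    have "\<not> real k \<le> real n / ln n / (72000000 * exp 4)"
      using no_tester_with_few_samples[OF _ dist, of k] enat n0[OF n] by auto
    thus ?thesis by (simp add: enat mult_ac)
  qed simp
  thus ?thesis
    by (intro exI[of _ "1 / 320"] exI[of _ "1 / (72000000 * exp 4)"]) auto
qed

end
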